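(* Let $X$ be a Peano graph whose ground space $\operatorname{Gr}(X)$ is homeomorphic to $V\times P$, where $V$ is a compact zero-dimensional metrizable space and $P$ is a Peano continuum with more than one point. Then the edge set admits a partition $E(X)=E_1\sqcup E_2$ such that for $i=1,2$ the closure $\overline{\bigcup E_i}$ contains $\operatorname{Gr}(X)$ and $\overline{\bigcup E_i}=\operatorname{Gr}(X)\cup\bigcup E_i$ is locally connected.
   Context: A Peano continuum is a compact connected locally connected metrizable space. A free arc (edge) is an inclusion-maximal open subset homeomorphic to $(0,1)$; $E(X)$ is the set of edges and $\operatorname{Gr}(X)=X\setminus\bigcup E(X)$ the ground space. A Peano graph is a Peano continuum in which $\bigcup E(X)$ is dense. *)

theory Defs
  imports "HOL-Analysis.Analysis"
begin

text \<open>Metrizable spaces are represented as subsets of metric-space types,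
  carrying the subspace topology.\<close>

definition peano_continuum :: "'a::metric_space set \<Rightarrow> bool" where
  "peano_continuum X \<longleftrightarrow> X \<noteq> {} \<and> compact X \<and> connected X \<and> locally connected X"

definition free_open_arc :: "'a::metric_space set \<Rightarrow> 'a set \<Rightarrow> bool" where
  "free_open_arc X U \<longleftrightarrow> openin (top_of_set X) U \<and> U homeomorphic {0<..<(1::real)}"

definition edges :: "'a::metric_space set \<Rightarrow> 'a set set" where
  "edges X = {U. free_open_arc X U \<and> (\<forall>U'. free_open_arc X U' \<and> U \<subseteq> U' \<longrightarrow> U' = U)}"

definition ground :: "'a::metric_space set \<Rightarrow> 'a set" where
  "ground X = X - \<Union>(edges X)"

definition peano_graph :: "'a::metric_space set \<Rightarrow> bool" where
  "peano_graph X \<longleftrightarrow> peano_continuum X \<and> X \<subseteq> closure (\<Union>(edges X))"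

definition zero_dimensional :: "'a::metric_space set \<Rightarrow> bool" where
  "zero_dimensional V \<longleftrightarrow>
     (\<forall>x\<in>V. \<forall>U. openin (top_of_set V) U \<and> x \<in> U \<longrightarrow>
        (\<exists>W. openin (top_of_set V) W \<and> closedin (top_of_set V) W \<and> x \<in> W \<and> W \<subseteq> U))"

end

theory Submission
  imports Defs
begin

text \<open>The connections between different copies \<open>{v} \<times> P\<close> of \<open>P\<close> are needed for local connectedness,
  and they can be found inside arbitrarily small places: if a clopen set of \<open>V\<close> splits into two
  parts at distance \<open>g\<close>, then near any prescribed point \<open>c\<close> of \<open>P\<close> a small connected subset of \<open>X\<close>
  joins nearest points of the two parts and hence contains an edge crossing the split, of length at
  least \<open>g\<close> and not much more when measured in \<open>V\<close>. As \<open>P\<close> has no isolated points, one can choose,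
  for every scale of \<open>g\<close>, two disjoint finite nets of places in \<open>P\<close>, and give an edge the colour of
  the place it uses at its scale. Either colour alone then prevents small neighbourhoods in the
  ground space from being disconnected. Edges that return to the same copy of \<open>P\<close> do not matter for
  this, and are distributed so that both classes are dense.\<close>

text \<open>The colour of an edge must be fixed before any point, neighbourhood or splitting is
  named, so it may depend only on the edge: on the distance in \<open>V\<close> between its ends and
  on the \<open>P\<close>-coordinate of one end. The edge found across a splitting has
  \<open>V\<close>-length between the minimal distance g of the two parts and a bound that comes
  from moduli of continuity and of local connectedness. Hence scales are windows between
  \<open>t (n + 2)\<close> and \<open>t n\<close> of a fast decreasing sequence, built so that links
  across distances below \<open>t (n + 1)\<close> produce lengths below \<open>t n\<close>. Such
  windows overlap only with their neighbours. The crossing edge lies over a nearest pair, anywhere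
  in the clopen set and perhaps far from the points to be joined. This does no harm, because pieces
  of all copies of \<open>P\<close> over a small clopen set stay in the given neighbourhood. Maximal
  free arcs may overlap: on a circle, the complement of every point is one. Overlaps are excluded
  once the ground space is nonempty; the empty case is settled directly.\<close>

section \<open>Compact metric spaces: gaps, separations, uniform local connectedness\<close>

lemma compact_nearest_pair:
  fixes A B :: "'a::metric_space set"
  assumes "compact A" "compact B" "A \<noteq> {}" "B \<noteq> {}"
  obtains a b where "a \<in> A" "b \<in> B" "\<And>x y. \<lbrakk>x \<in> A; y \<in> B\<rbrakk> \<Longrightarrow> dist a b \<le> dist x y"
proof -
  have "continuous_on (A \<times> B) (\<lambda>z. dist (fst z) (snd z))" by (intro continuous_intros)
  then obtain z where "z \<in> A \<times> B" "\<forall>u\<in>A \<times> B. dist (fst z) (snd z) \<le> dist (fst u) (snd u)"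
    using continuous_attains_inf[of "A \<times> B" "\<lambda>z. dist (fst z) (snd z)"] assms compact_Times by blast
  then show thesis using that[of "fst z" "snd z"] by auto
qed

lemma compact_disjoint_gap:
  fixes A B :: "'a::metric_space set"
  assumes "compact A" "compact B" "A \<inter> B = {}"
  obtains d where "0 < d" "\<And>x y. \<lbrakk>x \<in> A; y \<in> B\<rbrakk> \<Longrightarrow> d \<le> dist x y"
proof (cases "A = {} \<or> B = {}")
  case True
  then show ?thesis using that[of 1] by auto
next
  case False
  then obtain a b where "a \<in> A" "b \<in> B" "\<And>x y. \<lbrakk>x \<in> A; y \<in> B\<rbrakk> \<Longrightarrow> dist a b \<le> dist x y"
    using compact_nearest_pair[OF assms(1,2)] by blast
  moreover have "a \<noteq> b" using calculation assms(3) by auto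
  ultimately show ?thesis using that[of "dist a b"] by auto
qed

lemma openin_dist:
  fixes S :: "'a::metric_space set"
  assumes "openin (top_of_set S) U" "x \<in> U"
  obtains e where "0 < e" "\<And>y. \<lbrakk>y \<in> S; dist y x < e\<rbrakk> \<Longrightarrow> y \<in> U"
  using assms unfolding openin_euclidean_subtopology_iff by metis

text \<open>Quasi-components and components agree in a compact Hausdorff space, so two points in no
  common connected subset are separated by a clopen set. This turns a failure of local connectedness
  into a splitting.\<close>

lemma compact_separation:
  fixes N :: "'a::metric_space set"
  assumes "compact N" "x \<in> N" "y \<in> N"
    and no: "\<And>C. \<lbrakk>connected C; C \<subseteq> N; x \<in> C; y \<in> C\<rbrakk> \<Longrightarrow> False"
  obtains A B where "compact A" "compact B" "A \<union> B = N" "A \<inter> B = {}" "x \<in> A" "y \<in> B"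
proof -
  let ?T = "top_of_set N"
  have eq: "quasi_components_of ?T = connected_components_of ?T"
    by (rule quasi_eq_connected_components_of)
      (use assms(1) in \<open>auto simp: compact_space_subtopology Hausdorff_space_subtopology\<close>)
  have "\<not> quasi_component_of ?T x y"
  proof
    assume "quasi_component_of ?T x y"
    moreover have "quasi_component_of_set ?T x \<in> connected_components_of ?T"
      using eq assms(2) by (metis imageI quasi_components_of_def topspace_euclidean_subtopology)
    ultimately have "connectedin ?T (quasi_component_of_set ?T x)"
      "x \<in> quasi_component_of_set ?T x" "y \<in> quasi_component_of_set ?T x"
      using connectedin_connected_components_of assms(2)
      by (auto simp: quasi_component_of_refl)
    then show False
      using no[of "quasi_component_of_set ?T x"] by (simp add: connectedin_subtopology)
  qed
  then obtain T where T: "closedin ?T T" "openin ?T T" "(x \<in> T) \<noteq> (y \<in> T)"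
    using assms(2,3) by (auto simp: quasi_component_of_def)
  have T': "closedin ?T (N - T)" "T \<subseteq> N"
    using T by (auto simp: closedin_diff openin_imp_subset)
  have c: "compact T" "compact (N - T)"
    using T T' assms(1) closedin_compact by blast+
  show thesis
  proof (cases "x \<in> T")
    case True
    show ?thesis
      by (rule that[of T "N - T"]) (use c T T' True assms in auto)
  next
    case False
    show ?thesis
      by (rule that[of "N - T" T]) (use c T T' False assms in auto)
  qed
qed

text \<open>A continuous map from a compact interval to a metric space is a quotient map onto its
  image, and quotients inherit local connectedness. This covers closed edges, also those whose two
  ends coincide.\<close>

lemma locally_connected_image_Icc:
  fixes \<gamma> :: "real \<Rightarrow> 'a::metric_space"
  assumes "continuous_on {a..b} \<gamma>"
  shows "locally connected (\<gamma> ` {a..b})"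
proof (rule locally_connected_quotient_image)
  show "locally connected {a..b}"
    by (simp add: convex_imp_locally_connected)
  fix T assume T: "T \<subseteq> \<gamma> ` {a..b}"
  show "openin (top_of_set {a..b}) ({a..b} \<inter> \<gamma> -` T) \<longleftrightarrow> openin (top_of_set (\<gamma> ` {a..b})) T"
    using Abstract_Topology_2.continuous_imp_quotient_map[OF assms refl compact_Icc T] by auto
qed

lemma locally_connected_ball:
  fixes X :: "'a::metric_space set"
  assumes "locally connected X" "x \<in> X" "0 < e"
  obtains C where "openin (top_of_set X) C" "connected C" "x \<in> C" "C \<subseteq> ball x e"
proof -
  have "openin (top_of_set X) (X \<inter> ball x e)"
    by (simp add: openin_open_Int)
  then show thesis
    using assms that unfolding locally_connected
    by (metis (no_types, lifting) Int_iff centre_in_ball le_inf_iff)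
qed

text \<open>\<open>d\<close> is a Lebesgue number of a cover by open sets with connected trace on
  \<open>X\<close>. A trace within \<open>e/2\<close> of its own centre lies within \<open>e\<close>
  of each of its points.\<close>

lemma uniformly_locally_connected:
  fixes X :: "'a::metric_space set"
  assumes "compact X" "locally connected X" "0 < e"
  obtains d where "0 < d"
    "\<And>x y. \<lbrakk>x \<in> X; y \<in> X; dist x y < d\<rbrakk> \<Longrightarrow> \<exists>C. connected C \<and> C \<subseteq> X \<and> x \<in> C \<and> y \<in> C \<and> C \<subseteq> ball x e"
proof -
  have "\<exists>O'. open O' \<and> connected (X \<inter> O') \<and> x \<in> O' \<and> X \<inter> O' \<subseteq> ball x (e/2)" if x: "x \<in> X" for x
  proof -
    have "0 < e/2" using assms by simp
    from locally_connected_ball[OF assms(2) x this]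
    obtain C where C: "openin (top_of_set X) C" "connected C" "x \<in> C" "C \<subseteq> ball x (e/2)" by blast
    then obtain O' where "open O'" "C = X \<inter> O'" by (auto simp: openin_open)
    then show ?thesis using C by auto
  qed
  then obtain W where W: "\<And>x. x \<in> X \<Longrightarrow> open (W x) \<and> connected (X \<inter> W x) \<and> x \<in> W x \<and> X \<inter> W x \<subseteq> ball x (e/2)"
    by metis
  obtain d where d: "0 < d" "\<And>x. x \<in> X \<Longrightarrow> \<exists>G \<in> W ` X. ball x d \<subseteq> G"
    by (rule Heine_Borel_lemma[OF assms(1), of "W ` X"]) (use W in auto)
  show thesis
  proof (rule that[OF d(1)])
    fix x y assume xy: "x \<in> X" "y \<in> X" "dist x y < d"
    then obtain z where z: "z \<in> X" "ball x d \<subseteq> W z" using d by blast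
    have "X \<inter> W z \<subseteq> ball x e"
    proof
      fix u assume "u \<in> X \<inter> W z"
      then have "u \<in> ball z (e/2)" "x \<in> X \<inter> W z" using W[OF z(1)] xy z d(1) by auto
      then have "dist z u < e/2" "dist z x < e/2" using W[OF z(1)] by (auto simp del: Int_iff)
      then show "u \<in> ball x e" using dist_triangle_half_r by (metis mem_ball)
    qed
    moreover have "x \<in> W z" "y \<in> W z" using z xy d(1) by auto
    ultimately show "\<exists>C. connected C \<and> C \<subseteq> X \<and> x \<in> C \<and> y \<in> C \<and> C \<subseteq> ball x e"
      using W[OF z(1)] xy by (intro exI[of _ "X \<inter> W z"]) auto
  qed
qed

lemma compact_finite_connected_cover:
  fixes X :: "'a::metric_space set"
  assumes "compact X" "locally connected X" "0 < e"
  obtains \<C> where "finite \<C>" "X = \<Union>\<C>"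
    "\<And>C. C \<in> \<C> \<Longrightarrow> connected C \<and> (\<forall>x\<in>C. \<forall>y\<in>C. dist x y < e)"
proof -
  let ?\<G> = "{C. openin (top_of_set X) C \<and> connected C \<and> (\<forall>x\<in>C. \<forall>y\<in>C. dist x y < e)}"
  have "X \<subseteq> \<Union>?\<G>"
  proof
    fix x assume x: "x \<in> X"
    have "0 < e/2" using assms by simp
    from locally_connected_ball[OF assms(2) x this]
    obtain C where C: "openin (top_of_set X) C" "connected C" "x \<in> C" "C \<subseteq> ball x (e/2)" by blast
    have "\<forall>u\<in>C. \<forall>v\<in>C. dist u v < e"
      using C(4) by (metis dist_triangle_half_r mem_ball subset_iff)
    then show "x \<in> \<Union>?\<G>" using C by blast
  qed
  moreover have "\<forall>C\<in>?\<G>. openin (top_of_set X) C" by auto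
  ultimately obtain \<C> where "\<C> \<subseteq> ?\<G>" "finite \<C>" "X \<subseteq> \<Union>\<C>"
    using assms(1) unfolding compact_eq_openin_cover by meson
  moreover have "\<Union>\<C> \<subseteq> X" using \<open>\<C> \<subseteq> ?\<G>\<close> openin_imp_subset by blast
  ultimately have "X = \<Union>\<C>" by blast
  show thesis
    by (rule that[OF \<open>finite \<C>\<close> \<open>X = \<Union>\<C>\<close>]) (use \<open>\<C> \<subseteq> ?\<G>\<close> in auto)
qed

section \<open>Free arcs and their ends\<close>

text \<open>Compactness gives a cluster point \<open>a\<close> at the end 0. Without convergence,
  the arc would leave a small connected neighbourhood \<open>C\<close> of \<open>a\<close>
  arbitrarily close to the end. The trace on \<open>C\<close> of the arc between two parameters
  outside \<open>C\<close> would then be clopen in \<open>C\<close>, hence all of \<open>C\<close>,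
  although \<open>a\<close> is not on the arc.\<close>

lemma free_arc_end_limit:
  fixes X :: "'a::metric_space set" and f :: "real \<Rightarrow> 'a"
  assumes "compact X" "locally connected X" and U: "openin (top_of_set X) U"
    and hom: "homeomorphism {0<..<1} U f g"
  obtains a where "a \<in> X - U" "(f \<longlongrightarrow> a) (at_right 0)"
proof -
  have UX: "U \<subseteq> X" using U openin_imp_subset by blast
  have fU: "f t \<in> U" if "0 < t" "t < 1" for t
    using hom that by (auto simp: homeomorphism_def)
  have inj: "s = t" if "f s = f t" "0 < s" "s < 1" "0 < t" "t < 1" for s t
    using hom that by (auto simp: homeomorphism_def) (metis greaterThanLessThan_iff)
  have op: "openin (top_of_set X) (f ` {u<..<v})" if "0 \<le> u" "v \<le> 1" for u v
  proof -
    have "{u<..<v} \<subseteq> {0<..<1}" using that by auto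
    then have "openin (top_of_set {0<..<1}) {u<..<v}" by (simp add: open_subset)
    then show ?thesis
      using homeomorphism_imp_open_map[OF hom] U openin_trans by blast
  qed
  have "\<forall>n. f (1 / (real n + 2)) \<in> X"
    using fU UX by (auto simp: field_simps subset_iff)
  then obtain a r where a: "a \<in> X" and r: "strict_mono (r :: nat \<Rightarrow> nat)"
    and lim: "((\<lambda>n. f (1 / (real n + 2))) \<circ> r) \<longlonglongrightarrow> a"
    using assms(1) unfolding compact_def by metis
  define \<tau> where "\<tau> n = 1 / (real (r n) + 2)" for n
  have \<tau>01: "0 < \<tau> n" "\<tau> n < 1" for n
    by (auto simp: \<tau>_def field_simps)
  have "(\<lambda>n. 1 / (real n + 2)) \<longlonglongrightarrow> 0"
    using LIMSEQ_ignore_initial_segment[OF lim_1_over_n, of 2] by (simp add: add.commute)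
  then have "((\<lambda>n. 1 / (real n + 2)) \<circ> r) \<longlonglongrightarrow> 0"
    using r LIMSEQ_subseq_LIMSEQ by blast
  then have \<tau>0: "\<tau> \<longlonglongrightarrow> 0" by (simp add: \<tau>_def[abs_def] o_def)
  have f\<tau>: "(\<lambda>n. f (\<tau> n)) \<longlonglongrightarrow> a" using lim by (simp add: \<tau>_def o_def)
  have ev: "\<forall>\<^sub>F n in sequentially. f (\<tau> n) \<in> W" if W: "openin (top_of_set X) W" "a \<in> W" for W
  proof -
    obtain T where T: "open T" "W = X \<inter> T" using W by (auto simp: openin_open)
    have "\<forall>\<^sub>F n in sequentially. f (\<tau> n) \<in> T"
      using topological_tendstoD[OF f\<tau> T(1)] T W by auto
    then show ?thesis
      by eventually_elim (use T fU UX \<tau>01 in auto)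
  qed
  have small: "\<forall>\<^sub>F n in sequentially. \<tau> n < s" if "0 < s" for s
    using order_tendstoD(2)[OF \<tau>0 that] .
  \<comment> \<open>If \<open>a\<close> were \<open>f s\<close>, the points
    \<open>f (\<tau> n)\<close> would eventually have parameters above \<open>s/2\<close>, while
    \<open>\<tau> n\<close> tends to 0.\<close>
  have aU: "a \<notin> U"
  proof
    assume "a \<in> U"
    then obtain s where s: "0 < s" "s < 1" "a = f s"
      using hom by (auto simp: homeomorphism_def image_iff)
    have "\<forall>\<^sub>F n in sequentially. f (\<tau> n) \<in> f ` {s/2<..<1}"
      by (rule ev) (use op[of "s/2" 1] s in auto)
    moreover have "\<forall>\<^sub>F n in sequentially. \<tau> n < s/2" using small[of "s/2"] s by simp
    ultimately have "\<forall>\<^sub>F n in sequentially. False"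
    proof eventually_elim
      case (elim n)
      then obtain t where t: "s/2 < t" "t < 1" "f (\<tau> n) = f t" by auto
      then have "\<tau> n = t" using inj \<tau>01 s by auto
      then show False using t elim by simp
    qed
    then show False by simp
  qed
  have "(f \<longlongrightarrow> a) (at_right 0)"
  proof (rule tendstoI, rule ccontr)
    fix e :: real assume e: "0 < e" and no: "\<not> (\<forall>\<^sub>F t in at_right 0. dist (f t) a < e)"
    obtain C where C: "openin (top_of_set X) C" "connected C" "a \<in> C" "C \<subseteq> ball a e"
      using locally_connected_ball[OF assms(2) a e] by blast
    have far: "\<exists>t. 0 < t \<and> t < s \<and> f t \<notin> C" if "0 < s" for s
    proof -
      have "\<exists>t. 0 < t \<and> t < s \<and> \<not> dist (f t) a < e"
        using no that unfolding eventually_at_right_field by blast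
      then show ?thesis using C(4) by (auto simp: dist_commute subset_iff)
    qed
    obtain v where v: "0 < v" "v < 1" "f v \<notin> C" using far[of 1] by auto
    have "\<forall>\<^sub>F n in sequentially. \<tau> n < v \<and> f (\<tau> n) \<in> C"
      using small[OF v(1)] ev[OF C(1,3)] by eventually_elim auto
    then obtain n where n: "\<tau> n < v" "f (\<tau> n) \<in> C"
      using eventually_happens' trivial_limit_sequentially by blast
    obtain u where u: "0 < u" "u < \<tau> n" "f u \<notin> C" using far \<tau>01 by blast
    have CX: "C \<subseteq> X" using C(1) openin_imp_subset by blast
    have "openin (top_of_set C) (C \<inter> f ` {u<..<v})"
      using op[of u v] u v CX by (meson inf_le1 inf_le2 less_imp_le openin_Int_open openin_subset_trans openin_subtopology_Int2 C(1) openin_Int)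
    \<comment> \<open>As \<open>f u\<close> and \<open>f v\<close> are outside \<open>C\<close>, the
      open and the closed subarc have the same trace on \<open>C\<close>.\<close>
    moreover have "closedin (top_of_set C) (C \<inter> f ` {u<..<v})"
    proof -
      have "continuous_on {u..v} f"
        using hom u v by (auto simp: homeomorphism_def intro: continuous_on_subset)
      then have "closed (f ` {u..v})"
        by (intro compact_imp_closed compact_continuous_image) auto
      moreover have "C \<inter> f ` {u<..<v} = C \<inter> f ` {u..v}"
        using u v by (force simp: less_le)
      ultimately show ?thesis by (simp add: closedin_closed_Int)
    qed
    ultimately have "C \<inter> f ` {u<..<v} = {} \<or> C \<inter> f ` {u<..<v} = C"
      using C(2) connected_clopen by blast
    then have "a \<in> f ` {u<..<v}" using n u C(3) by auto
    then show False using aU fU u v by auto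
  qed
  with a aU show thesis using that by blast
qed

text \<open>Injectivity is asked only on the open interval, because the two ends of an edge may
  coincide. The last clause encodes openness of the arc in \<open>X\<close> together with continuity
  of the inverse.\<close>

definition arc_path :: "'a::metric_space set \<Rightarrow> 'a set \<Rightarrow> (real \<Rightarrow> 'a) \<Rightarrow> bool" where
  "arc_path X U \<gamma> \<longleftrightarrow> continuous_on {0..1} \<gamma> \<and> inj_on \<gamma> {0<..<1} \<and> \<gamma> ` {0<..<1} = U \<and>
     \<gamma> 0 \<in> X - U \<and> \<gamma> 1 \<in> X - U \<and>
     (\<forall>S. open S \<and> S \<subseteq> {0<..<1} \<longrightarrow> openin (top_of_set X) (\<gamma> ` S))"

lemma arc_path_exists:
  fixes X :: "'a::metric_space set"
  assumes "compact X" "locally connected X" "free_open_arc X U"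
  obtains \<gamma> where "arc_path X U \<gamma>"
proof -
  have U: "openin (top_of_set X) U" using assms by (simp add: free_open_arc_def)
  have "{0<..<(1::real)} homeomorphic U"
    using assms(3) homeomorphic_sym unfolding free_open_arc_def by blast
  then obtain f g where hom: "homeomorphism {0<..<(1::real)} U f g" by (auto simp: homeomorphic_def)
  obtain a where a: "a \<in> X - U" "(f \<longlongrightarrow> a) (at_right 0)"
    using free_arc_end_limit[OF assms(1,2) U hom] .
  have hom2: "homeomorphism {0<..<(1::real)} U (f \<circ> (\<lambda>t. 1 - t)) ((\<lambda>t. 1 - t) \<circ> g)"
    by (rule homeomorphism_compose[OF _ hom])
      (auto simp: homeomorphism_def image_iff intro!: continuous_intros bexI[of _ "1 - x" for x])
  obtain b where b: "b \<in> X - U" "((f \<circ> (\<lambda>t. 1 - t)) \<longlongrightarrow> b) (at_right 0)"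
    using free_arc_end_limit[OF assms(1,2) U hom2] .
  have b': "(f \<longlongrightarrow> b) (at_left 1)"
  proof -
    have "filterlim (\<lambda>t::real. 1 - t) (at_right 0) (at_left 1)"
      unfolding filterlim_at by (auto intro!: tendsto_eq_intros simp: eventually_at_filter)
    from filterlim_compose[OF b(2) this] show ?thesis by (simp add: o_def)
  qed
  define \<gamma> where "\<gamma> t = (if t \<le> 0 then a else if 1 \<le> t then b else f t)" for t :: real
  have eq: "\<gamma> t = f t" if "t \<in> {0<..<1}" for t using that by (simp add: \<gamma>_def)
  have contf: "continuous_on {0<..<1} f" and imf: "f ` {0<..<1} = U" and injf: "inj_on f {0<..<1}"
    using hom by (auto simp: homeomorphism_def intro: inj_on_inverseI)
  have \<gamma>0: "\<gamma> 0 = a" and \<gamma>1: "\<gamma> 1 = b" by (auto simp: \<gamma>_def)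
  have "continuous_on {0..1} \<gamma>"
  proof -
    have "continuous_on {0<..<1} \<gamma>" using contf by (rule continuous_on_eq) (simp add: eq)
    moreover have "(\<gamma> \<longlongrightarrow> \<gamma> 0) (at_right 0)"
    proof -
      have "\<forall>\<^sub>F t in at_right 0. f t = \<gamma> t"
        using eventually_at_right_real[of 0 1] by (rule eventually_mono) (auto simp: \<gamma>_def)
      from tendsto_cong[THEN iffD1, OF this a(2)] show ?thesis by (simp add: \<gamma>0)
    qed
    moreover have "(\<gamma> \<longlongrightarrow> \<gamma> 1) (at_left 1)"
    proof -
      have "\<forall>\<^sub>F t in at_left 1. f t = \<gamma> t"
        using eventually_at_left_real[of 0 1] by (rule eventually_mono) (auto simp: \<gamma>_def)
      from tendsto_cong[THEN iffD1, OF this b'] show ?thesis by (simp add: \<gamma>1)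
    qed
    ultimately show ?thesis
      by (intro continuous_on_IccI) (auto simp: continuous_on_eq_continuous_at isCont_def)
  qed
  moreover have "openin (top_of_set X) (\<gamma> ` S)" if S: "open S" "S \<subseteq> {0<..<1}" for S
  proof -
    have "openin (top_of_set U) (f ` S)"
      using homeomorphism_imp_open_map[OF hom] S by (simp add: open_subset)
    moreover have "\<gamma> ` S = f ` S" by (rule image_cong[OF refl]) (use S eq in auto)
    ultimately show ?thesis using U openin_trans by metis
  qed
  moreover have "inj_on \<gamma> {0<..<1}" using injf by (simp add: inj_on_def eq)
  moreover have "\<gamma> ` {0<..<1} = U" using imf eq by (metis (no_types, lifting) image_cong)
  ultimately show thesis using that[of \<gamma>] a b by (simp add: arc_path_def \<gamma>0 \<gamma>1)
qed

lemma arc_path_reverse: "arc_path X U \<gamma> \<Longrightarrow> arc_path X U (\<lambda>t. \<gamma> (1 - t))"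
proof -
  assume A: "arc_path X U \<gamma>"
  have im: "(\<lambda>t. \<gamma> (1 - t)) ` S = \<gamma> ` ((\<lambda>t. 1 - t) ` S)" for S by (simp add: image_image)
  have r: "(\<lambda>t. 1 - t) ` {0<..<1} = {0<..<(1::real)}"
    by (auto simp: image_iff intro!: bexI[of _ "1 - _"])
  have "continuous_on {0..1} (\<lambda>t. \<gamma> (1 - t))"
    by (rule continuous_on_compose2[of "{0..1}" \<gamma>]) (use A in \<open>auto simp: arc_path_def intro!: continuous_intros\<close>)
  moreover have "inj_on (\<lambda>t. \<gamma> (1 - t)) {0<..<1}"
  proof (rule inj_onI)
    fix x y :: real assume xy: "x \<in> {0<..<1}" "y \<in> {0<..<1}" "\<gamma> (1 - x) = \<gamma> (1 - y)"
    have "inj_on \<gamma> {0<..<1}" using A by (simp add: arc_path_def)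
    from inj_onD[OF this xy(3)] show "x = y" using xy by auto
  qed
  moreover have "openin (top_of_set X) ((\<lambda>t. \<gamma> (1 - t)) ` S)" if S: "open S" "S \<subseteq> {0<..<1}" for S
  proof -
    have "(\<lambda>t. 1 - t) ` S = (\<lambda>t. 1 - t) -` S" by (force simp: image_iff)
    moreover have "open ((\<lambda>t. 1 - t) -` S)" using S by (intro open_vimage continuous_intros) auto
    ultimately have "open ((\<lambda>t. 1 - t) ` S)" by simp
    moreover have "(\<lambda>t. 1 - t) ` S \<subseteq> {0<..<1}" using S by force
    ultimately show ?thesis unfolding im using A by (simp add: arc_path_def)
  qed
  ultimately show ?thesis using A unfolding arc_path_def im r by simp
qed

lemma arc_path_closure:
  assumes "arc_path X U \<gamma>"
  shows "compact (\<gamma> ` {0..1})" "\<gamma> ` {0..1} = insert (\<gamma> 0) (insert (\<gamma> 1) U)" "closure U = \<gamma> ` {0..1}"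
proof -
  have cont: "continuous_on {0..1} \<gamma>" and im: "\<gamma> ` {0<..<1} = U"
    using assms by (auto simp: arc_path_def)
  show c: "compact (\<gamma> ` {0..1})" by (intro compact_continuous_image cont) auto
  have "{0..1} = insert 0 (insert 1 {0<..<1::real})" by auto
  then show "\<gamma> ` {0..1} = insert (\<gamma> 0) (insert (\<gamma> 1) U)" using im by auto
  have "closure {0<..<1} = {0..1::real}" by simp
  then have "\<gamma> ` {0..1} \<subseteq> closure U"
    using image_closure_subset[of "{0<..<1}" \<gamma> "closure U"] cont im closure_subset[of U] by simp
  moreover have "closure U \<subseteq> \<gamma> ` {0..1}"
    by (rule closure_minimal) (use im c compact_imp_closed in force)+
  ultimately show "closure U = \<gamma> ` {0..1}" by simp
qed

section \<open>Charts around a point of an edge, and extension of an arc past its end\<close>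

definition arc_chart :: "'a::metric_space set \<Rightarrow> (real \<Rightarrow> 'a) \<Rightarrow> bool" where
  "arc_chart X g \<longleftrightarrow> continuous_on {-1<..<1} g \<and> inj_on g {-1<..<1} \<and>
     (\<forall>S. open S \<and> S \<subseteq> {-1<..<1} \<longrightarrow> openin (top_of_set X) (g ` S))"

lemma arc_chart_rescale:
  assumes s: "s \<noteq> 0" and c: "\<And>x. x \<in> {-1<..<1} \<Longrightarrow> c + s * x \<in> {l<..<u}"
    and cont: "continuous_on {l<..<u} f" and inj: "inj_on f {l<..<u}"
    and op: "\<And>S. open S \<Longrightarrow> S \<subseteq> {l<..<u} \<Longrightarrow> openin (top_of_set X) (f ` S)"
  shows "arc_chart X (\<lambda>x::real. f (c + s * x))"
  unfolding arc_chart_def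
proof (intro conjI allI impI)
  show "continuous_on {- 1<..<1} (\<lambda>x. f (c + s * x))"
    by (rule continuous_on_compose2[OF cont]) (use c in \<open>auto intro!: continuous_intros\<close>)
  show "inj_on (\<lambda>x. f (c + s * x)) {- 1<..<1}"
  proof (rule inj_onI)
    fix x y assume xy: "x \<in> {-1<..<1}" "y \<in> {-1<..<1}" "f (c + s * x) = f (c + s * y)"
    have "c + s * x = c + s * y" by (rule inj_onD[OF inj xy(3)]) (use c xy in auto)
    then show "x = y" using s by simp
  qed
  fix S :: "real set" assume S: "open S \<and> S \<subseteq> {- 1<..<1}"
  have "(\<lambda>x. c + s * x) ` S = (\<lambda>y. (y - c) / s) -` S"
    using s by (auto simp: image_iff field_simps intro!: bexI[of _ "(y - c) / s" for y])
  moreover have "open ((\<lambda>y. (y - c) / s) -` S)"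
    using S s by (intro open_vimage continuous_intros) auto
  ultimately have "open ((\<lambda>x. c + s * x) ` S)" by simp
  moreover have "(\<lambda>x. c + s * x) ` S \<subseteq> {l<..<u}" using S c by blast
  ultimately have "openin (top_of_set X) (f ` ((\<lambda>x. c + s * x) ` S))" by (rule op)
  then show "openin (top_of_set X) ((\<lambda>x. f (c + s * x)) ` S)" by (simp add: image_image)
qed

lemma arc_chart_flip: "arc_chart X g \<Longrightarrow> arc_chart X (\<lambda>x. g (- x))"
  using arc_chart_rescale[of "-1" 0 "-1" 1 g X] by (auto simp: arc_chart_def)

lemma arc_path_chart:
  assumes "arc_path X U \<gamma>" "a \<in> U"
  obtains g where "arc_chart X g" "g 0 = a" "g ` {-1<..<1} \<subseteq> U"
proof -
  have im: "\<gamma> ` {0<..<1} = U" using assms by (simp add: arc_path_def)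
  then obtain c where c: "0 < c" "c < 1" "a = \<gamma> c" using assms(2) by auto
  define s where "s = min c (1 - c)"
  have s: "0 < s" "s \<le> c" "s \<le> 1 - c" using c by (auto simp: s_def)
  have in01: "c + s * x \<in> {0<..<1}" if "x \<in> {-1<..<1}" for x
  proof -
    have "s * \<bar>x\<bar> < s * 1" by (rule mult_strict_left_mono) (use that s in auto)
    then have "\<bar>s * x\<bar> < s" using s by (simp add: abs_mult)
    then show ?thesis using s unfolding greaterThanLessThan_iff by linarith
  qed
  show thesis
  proof
    show "arc_chart X (\<lambda>x. \<gamma> (c + s * x))"
      by (rule arc_chart_rescale[of s c 0 1])
        (use s in01 assms(1) in \<open>auto simp: arc_path_def intro: continuous_on_subset\<close>)
    show "\<gamma> (c + s * 0) = a" using c by simp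
    show "(\<lambda>x. \<gamma> (c + s * x)) ` {- 1<..<1} \<subseteq> U" using in01 im by blast
  qed
qed

text \<open>Here \<open>\<sigma>\<close> records the side of the chart along which \<open>\<beta>\<close> leaves its centre.\<close>

lemma arc_chart_side:
  fixes X :: "'a::metric_space set" and \<beta> :: "real \<Rightarrow> 'a"
  assumes g: "arc_chart X g" and cont: "continuous_on {0..1} \<beta>" and "\<beta> ` {0..1} \<subseteq> X"
    and \<beta>0: "\<beta> 0 = g 0" and ne: "\<And>t. \<lbrakk>0 < t; t < 1\<rbrakk> \<Longrightarrow> \<beta> t \<noteq> g 0"
  obtains \<sigma> \<tau>0 where "\<sigma> = 1 \<or> \<sigma> = - 1" "0 < \<tau>0" "\<tau>0 < 1"
    "\<beta> ` {0<..\<tau>0} \<subseteq> (\<lambda>x. g (\<sigma> * x)) ` {0<..<1}"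
    "\<And>\<tau>. \<lbrakk>0 < \<tau>; \<tau> < 1\<rbrakk> \<Longrightarrow> \<exists>\<eta>. 0 < \<eta> \<and> \<eta> < 1 \<and> (\<lambda>x. g (\<sigma> * x)) ` {0..\<eta>} \<subseteq> \<beta> ` {0..\<tau>}"
proof -
  define W where "W = g ` {-1<..<1}"
  have W: "openin (top_of_set X) W" using g by (simp add: W_def arc_chart_def)
  have "openin (top_of_set {-1<..<1}) A \<Longrightarrow> openin (top_of_set W) (g ` A)" for A
  proof -
    assume "openin (top_of_set {-1<..<1}) A"
    then have "open A" "A \<subseteq> {-1<..<1}"
      using openin_open_eq[of "{-1<..<1::real}"] by auto
    then have "openin (top_of_set X) (g ` A)" "g ` A \<subseteq> W" "W \<subseteq> X"
      using g openin_imp_subset[OF W] by (auto simp: arc_chart_def W_def)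
    then show ?thesis by (rule openin_subset_trans)
  qed
  then obtain h where hom: "homeomorphism {-1<..<1} W g h"
    using homeomorphism_injective_open_map[of "{-1<..<1}" g W] g
    by (auto simp: arc_chart_def W_def)
  obtain T where T: "open T" "W = X \<inter> T" using W by (auto simp: openin_open)
  have "g 0 \<in> W" by (auto simp: W_def)
  then have "\<beta> 0 \<in> T" using T \<beta>0 by auto
  obtain e where e: "0 < e" "ball (\<beta> 0) e \<subseteq> T" using T(1) \<open>\<beta> 0 \<in> T\<close> by (auto simp: open_contains_ball)
  have "\<exists>d>0. \<forall>t\<in>{0..1}. dist t 0 < d \<longrightarrow> dist (\<beta> t) (\<beta> 0) < e"
    using cont e(1) unfolding continuous_on_iff by (metis atLeastAtMost_iff order_refl zero_le_one)
  then obtain d where d: "0 < d" "\<And>t. \<lbrakk>0 \<le> t; t \<le> 1; t < d\<rbrakk> \<Longrightarrow> dist (\<beta> t) (\<beta> 0) < e"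
    by (auto simp: dist_real_def)
  define \<tau>0 where "\<tau>0 = min (d/2) (1/2)"
  have \<tau>0: "0 < \<tau>0" "\<tau>0 < 1" "\<tau>0 < d" using d(1) by (auto simp: \<tau>0_def)
  have \<beta>W: "\<beta> t \<in> W" if "0 \<le> t" "t \<le> \<tau>0" for t
  proof -
    have "\<beta> t \<in> T" using d(2)[of t] that \<tau>0 e(2) by (auto simp: dist_commute)
    then show ?thesis using T assms(3) that \<tau>0 by auto
  qed
  define \<psi> where "\<psi> t = h (\<beta> t)" for t
  have g\<psi>: "g (\<psi> t) = \<beta> t" "\<psi> t \<in> {-1<..<1}" if "0 \<le> t" "t \<le> \<tau>0" for t
    using hom \<beta>W[OF that] by (auto simp: \<psi>_def homeomorphism_def)
  have cont\<psi>: "continuous_on {0..\<tau>0} \<psi>"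
    unfolding \<psi>_def
  proof (rule continuous_on_compose2[of W h])
    show "continuous_on W h" using hom by (simp add: homeomorphism_def)
    show "continuous_on {0..\<tau>0} \<beta>" using cont by (rule continuous_on_subset) (use \<tau>0 in auto)
  qed (use \<beta>W in auto)
  have \<psi>0: "\<psi> 0 = 0" using hom \<beta>0 by (auto simp: \<psi>_def homeomorphism_def)
  have \<psi>ne: "\<psi> t \<noteq> 0" if "0 < t" "t \<le> \<tau>0" for t
    using g\<psi>[of t] ne[of t] that \<tau>0 by auto
  \<comment> \<open>\<open>\<psi>\<close> is the chart parameter of \<open>\<beta>\<close>. It has
    no zero on \<open>{0<..\<tau>0}\<close>, so by the intermediate value theorem its sign is
    constant there and can be read off at \<open>\<tau>0\<close>.\<close>
  define \<sigma> where "\<sigma> = sgn (\<psi> \<tau>0)"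
  have \<sigma>: "\<sigma> = 1 \<or> \<sigma> = -1" using \<psi>ne[of \<tau>0] \<tau>0 by (auto simp: \<sigma>_def sgn_if)
  have pos: "0 < \<sigma> * \<psi> t" if t: "0 < t" "t \<le> \<tau>0" for t
  proof (rule ccontr)
    assume "\<not> 0 < \<sigma> * \<psi> t"
    moreover have "0 < \<sigma> * \<psi> \<tau>0" using \<psi>ne[of \<tau>0] \<tau>0 by (auto simp: \<sigma>_def sgn_if)
    moreover have "continuous_on {t..\<tau>0} (\<lambda>x. \<sigma> * \<psi> x)"
      using cont\<psi> t by (auto intro!: continuous_intros intro: continuous_on_subset)
    ultimately obtain x where "t \<le> x" "x \<le> \<tau>0" "\<sigma> * \<psi> x = 0"
      using IVT'[of "\<lambda>x. \<sigma> * \<psi> x" t 0 \<tau>0] t by auto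
    then show False using \<psi>ne[of x] t \<sigma> by auto
  qed
  have \<sigma>\<sigma>: "\<sigma> * (\<sigma> * x) = x" for x using \<sigma> by auto
  show thesis
  proof
    show "\<sigma> = 1 \<or> \<sigma> = -1" by (rule \<sigma>)
    show "0 < \<tau>0" "\<tau>0 < 1" using \<tau>0 by auto
    show "\<beta> ` {0<..\<tau>0} \<subseteq> (\<lambda>x. g (\<sigma> * x)) ` {0<..<1}"
    proof clarify
      fix t assume t: "t \<in> {0<..\<tau>0}"
      then have "\<sigma> * \<psi> t \<in> {0<..<1}" using pos[of t] g\<psi>(2)[of t] \<sigma> by auto
      moreover have "\<beta> t = g (\<sigma> * (\<sigma> * \<psi> t))" unfolding \<sigma>\<sigma> using g\<psi>(1)[of t] t by auto
      ultimately show "\<beta> t \<in> (\<lambda>x. g (\<sigma> * x)) ` {0<..<1}" by blast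
    qed
    fix \<tau> :: real assume \<tau>: "0 < \<tau>" "\<tau> < 1"
    define \<tau>' where "\<tau>' = min \<tau> \<tau>0"
    have \<tau>': "0 < \<tau>'" "\<tau>' \<le> \<tau>" "\<tau>' \<le> \<tau>0" using \<tau> \<tau>0 by (auto simp: \<tau>'_def)
    define \<eta> where "\<eta> = \<sigma> * \<psi> \<tau>'"
    have \<eta>: "0 < \<eta>" "\<eta> < 1" using pos[of \<tau>'] g\<psi>(2)[of \<tau>'] \<tau>' \<sigma> by (auto simp: \<eta>_def)
    have "(\<lambda>x. g (\<sigma> * x)) ` {0..\<eta>} \<subseteq> \<beta> ` {0..\<tau>}"
    proof clarify
      fix x assume x: "x \<in> {0..\<eta>}"
      have "continuous_on {0..\<tau>'} (\<lambda>x. \<sigma> * \<psi> x)"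
        using cont\<psi> \<tau>' by (auto intro!: continuous_intros intro: continuous_on_subset)
      then obtain t where "0 \<le> t" "t \<le> \<tau>'" "\<sigma> * \<psi> t = x"
        using IVT'[of "\<lambda>x. \<sigma> * \<psi> x" 0 x \<tau>'] x \<psi>0 \<tau>' by (auto simp: \<eta>_def)
      moreover then have "\<sigma> * x = \<psi> t" using \<sigma>\<sigma> by metis
      ultimately have "0 \<le> t" "t \<le> \<tau>'" "g (\<sigma> * x) = \<beta> t" using g\<psi>(1)[of t] \<tau>' by auto
      then show "g (\<sigma> * x) \<in> \<beta> ` {0..\<tau>}" using \<tau>' by auto
    qed
    then show "\<exists>\<eta>. 0 < \<eta> \<and> \<eta> < 1 \<and> (\<lambda>x. g (\<sigma> * x)) ` {0..\<eta>} \<subseteq> \<beta> ` {0..\<tau>}"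
      using \<eta> by blast
  qed
qed

text \<open>\<open>F\<close> runs along half of the chart up to \<open>g 0\<close> and continues
  along \<open>\<gamma>\<close>. The hypothesis \<open>disj\<close> makes it injective. Openness at
  the junction comes from \<open>side\<close>: the other half of the chart is covered near
  \<open>g 0\<close> by an initial piece of \<open>\<gamma>\<close>.\<close>

lemma free_open_arc_extend:
  fixes X :: "'a::metric_space set"
  assumes g: "arc_chart X g" and \<gamma>: "arc_path X U \<gamma>" and g0: "\<gamma> 0 = g 0"
    and side: "\<And>\<tau>. \<lbrakk>0 < \<tau>; \<tau> < 1\<rbrakk> \<Longrightarrow> \<exists>\<eta>. 0 < \<eta> \<and> \<eta> < 1 \<and> g ` {0..\<eta>} \<subseteq> \<gamma> ` {0..\<tau>}"
    and \<eta>: "0 < \<eta>" "\<eta> < 1" and disj: "g ` {-\<eta>..<0} \<inter> U = {}"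
  shows "free_open_arc X (U \<union> g ` {-\<eta><..0})"
proof -
  define F where "F t = (if t \<le> 0 then g (\<eta> * t) else \<gamma> t)" for t
  have im: "\<gamma> ` {0<..<1} = U" and a: "g 0 \<notin> U" and inj\<gamma>: "inj_on \<gamma> {0<..<1}"
    using \<gamma> g0 by (auto simp: arc_path_def)
  have sc: "\<eta> * t \<in> {-1<..0}" "-\<eta> < \<eta> * t" if "-1 < t" "t \<le> 0" for t
  proof -
    have "\<eta> * (-1) < \<eta> * t" using that \<eta> by (intro mult_strict_left_mono) auto
    moreover have "\<eta> * t \<le> 0" using that \<eta> by (simp add: mult_nonneg_nonpos)
    ultimately show "\<eta> * t \<in> {-1<..0}" "-\<eta> < \<eta> * t" using \<eta> by auto
  qed
  have injg: "x = y" if "g x = g y" "x \<in> {-1<..<1}" "y \<in> {-1<..<1}" for x y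
    using g that by (auto simp: arc_chart_def inj_on_def)
  have gU: "g (\<eta> * t) \<notin> U" if "-1 < t" "t \<le> 0" for t
  proof (cases "t = 0")
    case False
    then have "\<eta> * t < 0" using that \<eta> by (simp add: mult_pos_neg)
    then have "\<eta> * t \<in> {-\<eta>..<0}" using sc[OF that] by auto
    then show ?thesis using disj by blast
  qed (use a in simp)
  have imF: "F ` {-1<..<1} = U \<union> g ` {-\<eta><..0}"
  proof -
    have "{-1<..<1} = {-1<..0} \<union> {0<..<1::real}" by auto
    then have "F ` {-1<..<1} = (\<lambda>t. g (\<eta> * t)) ` {-1<..0} \<union> \<gamma> ` {0<..<1}"
      by (auto simp: F_def image_Un)
    moreover have "(\<lambda>t. \<eta> * t) ` {-1<..0} = {-\<eta><..0}"
    proof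
      show "{-\<eta><..0} \<subseteq> (\<lambda>t. \<eta> * t) ` {-1<..0}"
      proof
        fix x assume "x \<in> {-\<eta><..0}"
        then show "x \<in> (\<lambda>t. \<eta> * t) ` {-1<..0}"
          using \<eta> by (intro image_eqI[of _ _ "x / \<eta>"]) (auto simp: field_simps)
      qed
    qed (use sc in auto)
    ultimately show ?thesis using im by (metis Un_commute image_image)
  qed
  have cont: "continuous_on {-1<..<1} F"
    unfolding F_def
  proof (rule continuous_on_cases_le[of _ "\<lambda>t. t"])
    show "continuous_on {t \<in> {- 1<..<1}. t \<le> 0} (\<lambda>t. g (\<eta> * t))"
      by (rule continuous_on_compose2[of "{-1<..<1}" g])
        (use g sc in \<open>force simp: arc_chart_def intro!: continuous_intros\<close>)+
    show "continuous_on {t \<in> {- 1<..<1}. 0 \<le> t} \<gamma>"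
      by (rule continuous_on_subset[of "{0..1}"]) (use \<gamma> in \<open>auto simp: arc_path_def\<close>)
  qed (use g0 in auto)
  have inj: "inj_on F {-1<..<1}"
  proof (rule inj_onI)
    fix x y assume xy: "x \<in> {-1<..<1}" "y \<in> {-1<..<1}" "F x = F y"
    consider "x \<le> 0" "y \<le> 0" | "x > 0" "y > 0" | "x \<le> 0" "y > 0" | "x > 0" "y \<le> 0" by linarith
    then show "x = y"
    proof cases
      case 1
      then have "\<eta> * x = \<eta> * y" using xy sc[of x] sc[of y] by (intro injg) (auto simp: F_def)
      then show ?thesis using \<eta> by simp
    next
      case 2
      then show ?thesis using xy inj_onD[OF inj\<gamma>, of x y] by (auto simp: F_def)
    next
      case 3
      have "F x \<notin> U" using gU[of x] xy 3 by (simp add: F_def)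
      moreover have "\<gamma> y \<in> \<gamma> ` {0<..<1}" by (rule imageI) (use xy 3 in auto)
      then have "F y \<in> U" using 3 by (simp add: F_def im)
      ultimately show ?thesis using xy by simp
    next
      case 4
      have "F y \<notin> U" using gU[of y] xy 4 by (simp add: F_def)
      moreover have "\<gamma> x \<in> \<gamma> ` {0<..<1}" by (rule imageI) (use xy 4 in auto)
      then have "F x \<in> U" using 4 by (simp add: F_def im)
      ultimately show ?thesis using xy by simp
    qed
  qed
  have op: "openin (top_of_set X) (F ` S)" if S: "open S" "S \<subseteq> {-1<..<1}" for S
  proof -
    let ?N = "g ` ((\<lambda>t. \<eta> * t) ` (S \<inter> {..<0}))" and ?Q = "\<gamma> ` (S \<inter> {0<..})"
    have "(\<lambda>t. \<eta> * t) ` (S \<inter> {..<0}) = (\<lambda>x. x / \<eta>) -` (S \<inter> {..<0})"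
      using \<eta> by (auto simp: image_iff field_simps intro!: bexI[of _ "y / \<eta>" for y])
    moreover have "open ((\<lambda>x. x / \<eta>) -` (S \<inter> {..<0}))"
      using S \<eta> by (intro open_vimage continuous_intros) auto
    moreover have "(\<lambda>t. \<eta> * t) ` (S \<inter> {..<0}) \<subseteq> {-1<..<1}" using sc S by force
    ultimately have N: "openin (top_of_set X) ?N" using g by (simp add: arc_chart_def)
    have Q: "openin (top_of_set X) ?Q"
    proof -
      have "open (S \<inter> {0<..})" "S \<inter> {0<..} \<subseteq> {0<..<1}" using S by auto
      then show ?thesis using \<gamma> by (simp add: arc_path_def)
    qed
    show ?thesis
    proof (cases "0 \<in> S")
      case False
      then have "x < 0 \<or> 0 < x" if "x \<in> S" for x using that by (cases x "0::real" rule: linorder_cases) auto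
      then have "S = (S \<inter> {..<0}) \<union> (S \<inter> {0<..})" by auto
      then have "F ` S = F ` (S \<inter> {..<0}) \<union> F ` (S \<inter> {0<..})" by (metis image_Un)
      also have "F ` (S \<inter> {..<0}) = ?N" unfolding image_image by (rule image_cong) (auto simp: F_def)
      also have "F ` (S \<inter> {0<..}) = ?Q" by (rule image_cong) (auto simp: F_def)
      finally show ?thesis using N Q by (simp add: openin_Un)
    next
      case True
      then obtain e where e: "0 < e" "cball 0 e \<subseteq> S" using S by (meson open_contains_cball)
      then have eS: "t \<in> S" if "\<bar>t\<bar> \<le> e" for t using that by (auto simp: dist_real_def subset_iff)
      have "e < 1" using eS[of e] S e(1) by auto
      \<comment> \<open>Chart points on the positive side up to \<open>\<delta>\<close> have
        parameters at most \<open>e\<close> on \<open>\<gamma>\<close>, so the whole chart interval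
        \<open>?M\<close> lies in the image of \<open>S\<close>.\<close>
      then obtain \<delta> where \<delta>: "0 < \<delta>" "\<delta> < 1" "g ` {0..\<delta>} \<subseteq> \<gamma> ` {0..e}" using side e(1) by blast
      let ?M = "g ` {-(\<eta> * e)<..<\<delta>}"
      have "\<eta> * e < 1 * 1" using \<eta> e \<open>e < 1\<close> by (intro mult_strict_mono) auto
      then have "{-(\<eta> * e)<..<\<delta>} \<subseteq> {-1<..<1}" using \<delta> by auto
      then have M: "openin (top_of_set X) ?M" using g by (simp add: arc_chart_def)
      have "?M \<subseteq> F ` S"
      proof clarify
        fix x assume x: "x \<in> {-(\<eta> * e)<..<\<delta>}"
        show "g x \<in> F ` S"
        proof (cases "x < 0")
          case True
          have "x / \<eta> \<in> S" by (rule eS) (use x True \<eta> in \<open>auto simp: field_simps abs_if\<close>)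
          moreover have "F (x / \<eta>) = g x" using True \<eta> by (simp add: F_def field_simps)
          ultimately show ?thesis by force
        next
          case False
          then have "g x \<in> g ` {0..\<delta>}" using x by auto
          then have "g x \<in> \<gamma> ` {0..e}" using \<delta>(3) by blast
          then obtain t where t: "0 \<le> t" "t \<le> e" "g x = \<gamma> t" by auto
          then have "F t = g x" using g0 by (auto simp: F_def)
          then show ?thesis using eS[of t] t by (metis abs_of_nonneg imageI)
        qed
      qed
      moreover have "F ` S \<subseteq> ?N \<union> ?Q \<union> ?M"
      proof clarify
        fix t assume t: "t \<in> S" "F t \<notin> ?M" "F t \<notin> ?Q"
        have "F 0 \<in> ?M" using \<eta> e \<delta> by (auto simp: F_def)
        then have "t < 0" using t by (cases "t = 0") (auto simp: F_def not_less split: if_splits)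
        then show "F t \<in> ?N" using t by (auto simp: F_def)
      qed
      moreover have "?N \<subseteq> F ` S"
      proof -
        have "?N = F ` (S \<inter> {..<0})" unfolding image_image by (rule image_cong) (auto simp: F_def)
        then show ?thesis by blast
      qed
      moreover have "?Q \<subseteq> F ` S"
      proof -
        have "?Q = F ` (S \<inter> {0<..})" by (rule image_cong) (auto simp: F_def)
        then show ?thesis by blast
      qed
      ultimately have "F ` S = ?N \<union> ?Q \<union> ?M" by blast
      then show ?thesis using N Q M by (simp add: openin_Un)
    qed
  qed
  let ?U = "U \<union> g ` {-\<eta><..0}"
  have oU: "openin (top_of_set X) ?U" using op[of "{-1<..<1}"] imF by simp
  have "openin (top_of_set ?U) (F ` A)" if "openin (top_of_set {-1<..<1}) A" for A
  proof -
    have "open A" "A \<subseteq> {-1<..<1}" using that openin_open_eq[of "{-1<..<1::real}"] by auto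
    then have "openin (top_of_set X) (F ` A)" "F ` A \<subseteq> ?U" "?U \<subseteq> X"
      by (rule op) (use image_mono[of A "{-1<..<1}" F] \<open>A \<subseteq> {-1<..<1}\<close> imF openin_imp_subset[OF oU] in simp_all)
    then show ?thesis by (rule openin_subset_trans)
  qed
  then obtain k where "homeomorphism {-1<..<1} ?U F k"
    using homeomorphism_injective_open_map[OF cont imF inj] by blast
  then have "?U homeomorphic {-1<..<1::real}" using homeomorphic_def homeomorphic_sym by blast
  also have "{-1<..<1::real} homeomorphic {0<..<1::real}"
    unfolding homeomorphic_minimal
    by (rule exI[of _ "\<lambda>x. (x + 1) / 2"], rule exI[of _ "\<lambda>x. 2 * x - 1"])
      (auto simp: field_simps intro!: continuous_intros)
  finally show ?thesis using oU by (simp add: free_open_arc_def)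
qed

section \<open>Disjointness and size of the edges\<close>

lemma edgesD:
  assumes "U \<in> edges X"
  shows "free_open_arc X U" "openin (top_of_set X) U" "U \<subseteq> X" "connected U" "U \<noteq> {}"
    "\<And>U'. \<lbrakk>free_open_arc X U'; U \<subseteq> U'\<rbrakk> \<Longrightarrow> U' = U"
proof -
  show "free_open_arc X U" "openin (top_of_set X) U" "\<And>U'. \<lbrakk>free_open_arc X U'; U \<subseteq> U'\<rbrakk> \<Longrightarrow> U' = U"
    using assms by (auto simp: edges_def free_open_arc_def)
  then show "U \<subseteq> X" by (simp add: openin_imp_subset)
  have h: "U homeomorphic {0<..<1::real}" using assms by (auto simp: edges_def free_open_arc_def)
  show "connected U" using homeomorphic_connectedness[OF h] by simp
  show "U \<noteq> {}" using h by (auto simp: homeomorphic_def homeomorphism_def)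
qed

text \<open>If the edge \<open>U\<close> reaches a point of \<open>U'\<close> through its end, then either \<open>U\<close> can be extended
  beyond that end, contradicting maximality, or both ends of \<open>U\<close> meet there and \<open>X\<close> is a circle.\<close>

lemma edge_end_in_edge_ground_empty:
  fixes X :: "'a::metric_space set"
  assumes X: "compact X" "connected X" "locally connected X"
    and U: "U \<in> edges X" "U' \<in> edges X" and \<gamma>: "arc_path X U \<gamma>" and end0: "\<gamma> 0 \<in> U'"
  shows "ground X = {}"
proof -
  have cont: "continuous_on {0..1} \<gamma>" and im: "\<gamma> ` {0<..<1} = U" and inj: "inj_on \<gamma> {0<..<1}"
    and a: "\<gamma> 0 \<notin> U" and b: "\<gamma> 1 \<notin> U" and imX: "\<gamma> ` {0..1} \<subseteq> X"
    using \<gamma> arc_path_closure(2)[OF \<gamma>] edgesD(3)[OF U(1)] by (auto simp: arc_path_def)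
  obtain \<gamma>' where \<gamma>': "arc_path X U' \<gamma>'"
    using arc_path_exists[OF X(1,3) edgesD(1)[OF U(2)]] .
  obtain g0 where g0: "arc_chart X g0" "g0 0 = \<gamma> 0" "g0 ` {-1<..<1} \<subseteq> U'"
    using arc_path_chart[OF \<gamma>' end0] .
  have inU: "\<gamma> t \<in> U" if "0 < t" "t < 1" for t using im that by auto
  have \<gamma>ne: "\<gamma> t \<noteq> g0 0" if "0 < t" "t < 1" for t using inU[OF that] a g0(2) by metis
  obtain \<sigma> \<tau>0 where \<sigma>: "\<sigma> = 1 \<or> \<sigma> = - 1" and \<tau>0: "0 < \<tau>0" "\<tau>0 < 1"
    and in0: "\<gamma> ` {0<..\<tau>0} \<subseteq> (\<lambda>x. g0 (\<sigma> * x)) ` {0<..<1}"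
    and side0: "\<And>\<tau>. \<lbrakk>0 < \<tau>; \<tau> < 1\<rbrakk> \<Longrightarrow> \<exists>\<eta>. 0 < \<eta> \<and> \<eta> < 1 \<and> (\<lambda>x. g0 (\<sigma> * x)) ` {0..\<eta>} \<subseteq> \<gamma> ` {0..\<tau>}"
    by (rule arc_chart_side[OF g0(1) cont imX g0(2)[symmetric] \<gamma>ne], assumption, assumption, rule that)
  \<comment> \<open>The chart is flipped if necessary, so that \<open>\<gamma>\<close> starts along
    its positive half.\<close>
  define g where "g x = g0 (\<sigma> * x)" for x
  have g: "arc_chart X g" using \<sigma> g0(1) arc_chart_flip[OF g0(1)] by (auto simp: g_def[abs_def])
  have ga: "g 0 = \<gamma> 0" using g0 by (simp add: g_def)
  have gU': "g x \<in> U'" if "x \<in> {-1<..<1}" for x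
  proof -
    have "\<sigma> * x \<in> {-1<..<1}" using that \<sigma> by auto
    then show ?thesis using g0(3) by (auto simp: g_def)
  qed
  have in1: "\<gamma> ` {0<..\<tau>0} \<subseteq> g ` {0<..<1}"
    and side: "\<And>\<tau>. \<lbrakk>0 < \<tau>; \<tau> < 1\<rbrakk> \<Longrightarrow> \<exists>\<eta>. 0 < \<eta> \<and> \<eta> < 1 \<and> g ` {0..\<eta>} \<subseteq> \<gamma> ` {0..\<tau>}"
    using in0 side0 by (auto simp: g_def[abs_def])
  have injg: "x = y" if "g x = g y" "x \<in> {-1<..<1}" "y \<in> {-1<..<1}" for x y
    using g that by (auto simp: arc_chart_def inj_on_def)
  \<comment> \<open>Otherwise \<open>U\<close> could be prolonged through \<open>\<gamma> 0\<close>
    along the negative half, against maximality.\<close>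
  have meets: "\<exists>y\<in>{-\<eta>..<0}. g y \<in> U" if \<eta>: "0 < \<eta>" "\<eta> < 1" for \<eta>
  proof (rule ccontr)
    assume "\<not> ?thesis"
    then have "g ` {-\<eta>..<0} \<inter> U = {}" by blast
    from free_open_arc_extend[OF g \<gamma> ga[symmetric] side \<eta> this]
    have "U \<union> g ` {-\<eta><..0} = U" by (intro edgesD(6)[OF U(1)]) auto
    moreover have "g 0 \<in> g ` {-\<eta><..0}" using \<eta> by auto
    ultimately show False using a ga by auto
  qed
  \<comment> \<open>By \<open>meets\<close>, points of \<open>U\<close> accumulate at
    \<open>g 0\<close> on the negative half. They cannot have parameters up to
    \<open>\<tau>0\<close>, which belong to the positive half, and \<open>?K\<close> would stay away
    from \<open>g 0\<close> if the other end were elsewhere.\<close>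
  have loop: "\<gamma> 1 = g 0"
  proof (rule ccontr)
    assume ne: "\<gamma> 1 \<noteq> g 0"
    let ?K = "\<gamma> ` {\<tau>0..1}"
    have "compact ?K" using cont \<tau>0
      by (intro compact_continuous_image) (auto intro: continuous_on_subset)
    then have "open (- ?K)" by (simp add: compact_imp_closed open_Compl)
    moreover have "g 0 \<in> - ?K"
    proof
      assume "g 0 \<in> ?K"
      then obtain t where t: "\<tau>0 \<le> t" "t \<le> 1" "g 0 = \<gamma> t" by auto
      then have "t \<noteq> 1" using ne by auto
      then have "\<gamma> t \<in> U" using inU t \<tau>0 by auto
      then show False using t ga a by simp
    qed
    ultimately obtain e where e: "0 < e" "ball (g 0) e \<subseteq> - ?K" by (meson open_contains_ball)
    have "continuous_on {-1<..<1} g" using g by (simp add: arc_chart_def)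
    moreover have "(0::real) \<in> {-1<..<1}" by simp
    ultimately obtain d where d: "0 < d" "\<And>x. \<lbrakk>x \<in> {-1<..<1}; dist x 0 < d\<rbrakk> \<Longrightarrow> dist (g x) (g 0) < e"
      using e(1) unfolding continuous_on_iff by blast
    define \<eta> where "\<eta> = min (d/2) (1/2)"
    have \<eta>: "0 < \<eta>" "\<eta> < 1" "\<eta> < d" using d(1) by (auto simp: \<eta>_def)
    obtain y where y: "-\<eta> \<le> y" "y < 0" "g y \<in> U" using meets[OF \<eta>(1,2)] by auto
    then have "dist (g y) (g 0) < e" using d(2)[of y] \<eta> by (auto simp: dist_real_def)
    then have "g y \<notin> ?K" using e(2) by (auto simp: dist_commute subset_iff)
    moreover obtain t where t: "0 < t" "t < 1" "g y = \<gamma> t" using y(3) im by auto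
    ultimately have "t \<in> {0<..\<tau>0}" by (auto simp: image_iff not_le)
    then have "\<gamma> t \<in> g ` {0<..<1}" using in1 by blast
    then obtain x where "0 < x" "x < 1" "g y = g x" using t by auto
    then have "y = x" using injg[of y x] y \<eta> by auto
    then show False using y \<open>0 < x\<close> by simp
  qed
  have \<gamma>r: "arc_path X U (\<lambda>t. \<gamma> (1 - t))" by (rule arc_path_reverse[OF \<gamma>])
  have contr: "continuous_on {0..1} (\<lambda>t. \<gamma> (1 - t))" using \<gamma>r by (simp add: arc_path_def)
  have beg: "\<gamma> (1 - 0) = g 0" using loop by simp
  have ner: "\<gamma> (1 - t) \<noteq> g 0" if "0 < t" "t < 1" for t
    using inU[of "1 - t"] that ga a by auto
  have imr: "(\<lambda>t. \<gamma> (1 - t)) ` {0..1} \<subseteq> X" using imX by auto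
  obtain \<rho> \<tau>1 where \<rho>: "\<rho> = 1 \<or> \<rho> = - 1" and \<tau>1: "0 < \<tau>1" "\<tau>1 < (1::real)"
    and side1: "\<And>\<tau>. \<lbrakk>0 < \<tau>; \<tau> < 1\<rbrakk> \<Longrightarrow>
      \<exists>\<eta>. 0 < \<eta> \<and> \<eta> < 1 \<and> (\<lambda>x. g (\<rho> * x)) ` {0..\<eta>} \<subseteq> (\<lambda>t. \<gamma> (1 - t)) ` {0..\<tau>}"
    by (rule arc_chart_side[OF g contr imr beg ner], assumption, assumption, rule that)
  obtain \<eta> where \<eta>: "0 < \<eta>" "\<eta> < 1" "g ` {0..\<eta>} \<subseteq> \<gamma> ` {0..1/3}" using side[of "1/3"] by auto
  obtain \<eta>' where \<eta>': "0 < \<eta>'" "\<eta>' < 1" "(\<lambda>x. g (\<rho> * x)) ` {0..\<eta>'} \<subseteq> (\<lambda>t. \<gamma> (1 - t)) ` {0..1/3}"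
    using side1[of "1/3"] by auto
  \<comment> \<open>Were both ends of \<open>U\<close> to arrive along the same half, some point
    would have a parameter at most 1/3 and another at least 2/3. Any bound below 1/2 serves
    here.\<close>
  have "\<rho> = -1"
  proof (rule ccontr)
    assume "\<rho> \<noteq> -1"
    then have "\<rho> = 1" using \<rho> by blast
    define x where "x = min \<eta> \<eta>'"
    have x: "0 < x" "x \<le> \<eta>" "x \<le> \<eta>'" "x < 1" using \<eta> \<eta>' by (auto simp: x_def)
    then have "g x \<in> \<gamma> ` {0..1/3}" "g x \<in> (\<lambda>t. \<gamma> (1 - t)) ` {0..1/3}"
      using \<eta>(3) \<eta>'(3) \<open>\<rho> = 1\<close> by (auto simp: image_subset_iff)
    then obtain s t where s: "0 \<le> s" "s \<le> 1/3" "g x = \<gamma> s" and t: "0 \<le> t" "t \<le> 1/3" "g x = \<gamma> (1 - t)"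
      by auto
    have "g x \<noteq> g 0" using injg[of x 0] x by auto
    then have "s \<noteq> 0" "t \<noteq> 0" using s t ga loop by auto
    then have "s = 1 - t" using s t by (intro inj_onD[OF inj]) auto
    then show False using s t by simp
  qed
  have sub: "g ` {-\<eta>'<..<\<eta>} \<subseteq> \<gamma> ` {0..1}"
  proof clarify
    fix x assume x: "x \<in> {-\<eta>'<..<\<eta>}"
    show "g x \<in> \<gamma> ` {0..1}"
    proof (cases "0 \<le> x")
      case True
      then have "g x \<in> \<gamma> ` {0..1/3}" using x \<eta>(3) by auto
      then show ?thesis by auto
    next
      case False
      then have "- x \<in> {0..\<eta>'}" using x by auto
      then have "g (\<rho> * - x) \<in> (\<lambda>t. \<gamma> (1 - t)) ` {0..1/3}" using \<eta>'(3) by blast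
      then show ?thesis using \<open>\<rho> = -1\<close> by auto
    qed
  qed
  \<comment> \<open>The loop is compact, and it is open as the union of \<open>U\<close> and a chart
    interval; hence it is all of \<open>X\<close>, and its single point outside \<open>U\<close>
    belongs to \<open>U'\<close>.\<close>
  let ?Z = "\<gamma> ` {0..1}"
  have Z: "?Z = insert (\<gamma> 0) U" using arc_path_closure(2)[OF \<gamma>] loop ga by auto
  have "g 0 \<in> g ` {-\<eta>'<..<\<eta>}" using \<eta> \<eta>' by auto
  then have "?Z = U \<union> g ` {-\<eta>'<..<\<eta>}" using sub Z ga by auto
  moreover have "openin (top_of_set X) (g ` {-\<eta>'<..<\<eta>})"
  proof -
    have "{-\<eta>'<..<\<eta>} \<subseteq> {-1<..<1}" using \<eta> \<eta>' by auto
    then show ?thesis using g by (simp add: arc_chart_def)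
  qed
  ultimately have "openin (top_of_set X) ?Z" using edgesD(2)[OF U(1)] by (metis openin_Un)
  moreover have "closedin (top_of_set X) ?Z"
    using arc_path_closure(1)[OF \<gamma>] imX by (simp add: closed_subset compact_imp_closed)
  ultimately have "?Z = {} \<or> ?Z = X" using X(2) connected_clopen by blast
  then have "?Z = X" by auto
  then show ?thesis using Z U end0 by (auto simp: ground_def)
qed

text \<open>The ends of \<open>U\<close> avoid \<open>U'\<close>, so \<open>U\<close> has a clopen
  trace on the connected set \<open>U'\<close>; if the trace is nonempty, \<open>U'\<close> lies in
  \<open>U\<close> and maximality forces equality.\<close>

lemma edges_disjoint:
  fixes X :: "'a::metric_space set"
  assumes X: "compact X" "connected X" "locally connected X" "ground X \<noteq> {}"
    and U: "U \<in> edges X" "U' \<in> edges X" "U \<noteq> U'"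
  shows "U \<inter> U' = {}"
proof (rule ccontr)
  assume meet: "U \<inter> U' \<noteq> {}"
  obtain \<gamma> where \<gamma>: "arc_path X U \<gamma>" using arc_path_exists[OF X(1,3) edgesD(1)[OF U(1)]] .
  have "\<gamma> 0 \<notin> U'" using edge_end_in_edge_ground_empty[OF X(1-3) U(1,2) \<gamma>] X(4) by blast
  moreover have "\<gamma> 1 \<notin> U'"
    using edge_end_in_edge_ground_empty[OF X(1-3) U(1,2) arc_path_reverse[OF \<gamma>]] X(4) by auto
  ultimately have "U' \<inter> U = U' \<inter> \<gamma> ` {0..1}" using arc_path_closure(2)[OF \<gamma>] by auto
  moreover have "closed (\<gamma> ` {0..1})" using arc_path_closure(1)[OF \<gamma>] by (rule compact_imp_closed)
  ultimately have "closedin (top_of_set U') (U' \<inter> U)" by (simp add: closedin_closed_Int)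
  moreover have "openin (top_of_set U') (U' \<inter> U)"
    by (meson U edgesD(2,3) inf_le1 inf_le2 openin_Int openin_subset_trans)
  ultimately have "U' \<inter> U = U'" using meet connected_clopen[THEN iffD1, OF edgesD(4)[OF U(2)]] by blast
  then have "U' \<subseteq> U" by blast
  then show False using edgesD(6)[OF U(2) edgesD(1)[OF U(1)]] U(3) by blast
qed

section \<open>Edges over a nonempty ground space: ends, closures and sizes\<close>

definition edge_path :: "'a::metric_space set \<Rightarrow> 'a set \<Rightarrow> real \<Rightarrow> 'a" where
  "edge_path X e = (SOME \<gamma>. arc_path X e \<gamma>)"

locale edge_space =
  fixes X :: "'a::metric_space set"
  assumes compact_X: "compact X" and connected_X: "connected X" and lc_X: "locally connected X"
    and ground_ne: "ground X \<noteq> {}"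
begin

abbreviation "\<gamma> \<equiv> edge_path X"

lemma arc_path_edge: "e \<in> edges X \<Longrightarrow> arc_path X e (\<gamma> e)"
  unfolding edge_path_def using arc_path_exists[OF compact_X lc_X edgesD(1)] by (metis someI)

lemma disjoint_edges: "\<lbrakk>e \<in> edges X; e' \<in> edges X; x \<in> e; x \<in> e'\<rbrakk> \<Longrightarrow> e = e'"
  using edges_disjoint[OF compact_X connected_X lc_X ground_ne] by blast

lemma ends_ground:
  assumes e: "e \<in> edges X"
  shows "\<gamma> e 0 \<in> ground X" "\<gamma> e 1 \<in> ground X"
proof -
  note ar = arc_path_edge[OF e]
  have "\<gamma> e 0 \<notin> e'" "\<gamma> e 1 \<notin> e'" if e': "e' \<in> edges X" for e'
    using edge_end_in_edge_ground_empty[OF compact_X connected_X lc_X e e' ar]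
      edge_end_in_edge_ground_empty[OF compact_X connected_X lc_X e e' arc_path_reverse[OF ar]]
      ground_ne by auto
  then show "\<gamma> e 0 \<in> ground X" "\<gamma> e 1 \<in> ground X"
    using ar by (auto simp: ground_def arc_path_def)
qed

lemma edge_closure:
  assumes "e \<in> edges X"
  shows "compact (closure e)" "closure e = insert (\<gamma> e 0) (insert (\<gamma> e 1) e)" "closure e = \<gamma> e ` {0..1}"
    "connected (closure e)" "closure e \<subseteq> X" "locally connected (closure e)"
proof -
  note ar = arc_path_closure[OF arc_path_edge[OF assms]]
  show "compact (closure e)" "closure e = insert (\<gamma> e 0) (insert (\<gamma> e 1) e)"
    and c: "closure e = \<gamma> e ` {0..1}"
    using ar by auto
  show "connected (closure e)" using edgesD(4)[OF assms] by (rule connected_imp_connected_closure)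
  show "closure e \<subseteq> X"
    using edgesD(3)[OF assms] compact_imp_closed[OF compact_X] by (rule closure_minimal)
  show "locally connected (closure e)"
    unfolding c using arc_path_edge[OF assms] by (intro locally_connected_image_Icc) (simp add: arc_path_def)
qed

lemma closed_ground: "closed (ground X)" and compact_ground: "compact (ground X)"
proof -
  have "openin (top_of_set X) (\<Union>(edges X))" using edgesD(2) by blast
  then have "closedin (top_of_set X) (ground X)" by (simp add: ground_def openin_closedin_eq)
  then show "compact (ground X)" using compact_X closedin_compact by blast
  then show "closed (ground X)" by (rule compact_imp_closed)
qed

lemma edge_not_ground: "\<lbrakk>e \<in> edges X; x \<in> e\<rbrakk> \<Longrightarrow> x \<notin> ground X"
  by (auto simp: ground_def)

definition small_edge :: "real \<Rightarrow> 'a set \<Rightarrow> bool" where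
  "small_edge r e \<longleftrightarrow> (\<forall>x\<in>closure e. \<forall>y\<in>closure e. dist x y < r)"

lemma connected_in_edge:
  assumes "e \<in> edges X" "connected C" "C \<subseteq> X" "x \<in> C" "x \<in> e" "\<gamma> e 0 \<notin> C" "\<gamma> e 1 \<notin> C"
  shows "C \<subseteq> e"
proof -
  have eq: "C \<inter> e = C \<inter> closure e" using assms edge_closure(2)[OF assms(1)] by auto
  have "closedin (top_of_set C) (C \<inter> e)" unfolding eq by (simp add: closedin_closed_Int)
  moreover have "openin (top_of_set C) (C \<inter> e)"
    using openin_open_Int edgesD(2)[OF assms(1)] assms(3) openin_subtopology_Int_subset
    by (metis inf.absorb_iff2 inf_commute openin_Int_open openin_open inf_assoc)
  ultimately have "C \<inter> e = C" using assms(4,5) connected_clopen[THEN iffD1, OF assms(2)] by blast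
  then show ?thesis by blast
qed

text \<open>A large edge has a point at distance at least \<open>r/5\<close> from both ends:
  otherwise the balls of radius \<open>r/5\<close> about the ends cover the connected closure, hence
  overlap there, and all distances are below \<open>4*r/5\<close>. A connected piece of diameter
  below \<open>r/5\<close> through such a point misses the ends and so stays in the edge. Finitely
  many pieces cover \<open>X\<close>, and disjoint edges contain different pieces.\<close>

lemma finite_large_edges:
  assumes "0 < r"
  shows "finite {e \<in> edges X. \<not> small_edge r e}"
proof -
  obtain \<C> where \<C>: "finite \<C>" "X = \<Union>\<C>" "\<And>C. C \<in> \<C> \<Longrightarrow> connected C \<and> (\<forall>x\<in>C. \<forall>y\<in>C. dist x y < r/5)"
    using compact_finite_connected_cover[OF compact_X lc_X, of "r/5"] assms by auto
  have "\<exists>C\<in>\<C>. C \<noteq> {} \<and> C \<subseteq> e" if e: "e \<in> edges X" "\<not> small_edge r e" for e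
  proof -
    let ?a = "\<gamma> e 0" and ?b = "\<gamma> e 1"
    have "\<exists>x\<in>e. r/5 \<le> dist ?a x \<and> r/5 \<le> dist ?b x"
    proof (rule ccontr)
      assume "\<not> ?thesis"
      then have sub: "closure e \<subseteq> ball ?a (r/5) \<union> ball ?b (r/5)"
        using edge_closure(2)[OF e(1)] assms by (auto simp: not_le)
      have "ball ?a (r/5) \<inter> ball ?b (r/5) \<inter> closure e \<noteq> {}"
        using connectedD[OF edge_closure(4)[OF e(1)] open_ball open_ball _ sub] edge_closure(2)[OF e(1)] assms
        by fastforce
      then obtain m where m: "dist ?a m < r/5" "dist ?b m < r/5" by auto
      have xm: "dist x m < 2*r/5" if "x \<in> closure e" for x
      proof -
        have "dist ?a x < r/5 \<or> dist ?b x < r/5" using that sub by auto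
        then show ?thesis
          using m dist_triangle[of x m ?a] dist_triangle[of x m ?b] dist_commute[of x ?a] dist_commute[of x ?b]
          by linarith
      qed
      have "dist x y < r" if "x \<in> closure e" "y \<in> closure e" for x y
        using xm[OF that(1)] xm[OF that(2)] dist_triangle2[of x y m] assms by linarith
      then show False using e(2) by (simp add: small_edge_def)
    qed
    then obtain x where x: "x \<in> e" "r/5 \<le> dist ?a x" "r/5 \<le> dist ?b x" by blast
    obtain C where C: "C \<in> \<C>" "x \<in> C" using x(1) edgesD(3)[OF e(1)] \<C>(2) by blast
    have "C \<subseteq> e"
    proof (rule connected_in_edge[OF e(1)])
      show "\<gamma> e 0 \<notin> C" "\<gamma> e 1 \<notin> C" using \<C>(3)[OF C(1)] C(2) x by (meson not_le)+
    qed (use C \<C> x in auto)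
    then show ?thesis using C by blast
  qed
  then obtain c where c: "\<And>e. \<lbrakk>e \<in> edges X; \<not> small_edge r e\<rbrakk> \<Longrightarrow> c e \<in> \<C> \<and> c e \<noteq> {} \<and> c e \<subseteq> e"
    by metis
  have "inj_on c {e \<in> edges X. \<not> small_edge r e}"
  proof (rule inj_onI)
    fix e e' assume ee: "e \<in> {e \<in> edges X. \<not> small_edge r e}" "e' \<in> {e \<in> edges X. \<not> small_edge r e}" "c e = c e'"
    then obtain x where "x \<in> c e" using c by blast
    then show "e = e'" using disjoint_edges c ee by (metis (mono_tags, lifting) mem_Collect_eq subsetD)
  qed
  moreover have "c ` {e \<in> edges X. \<not> small_edge r e} \<subseteq> \<C>" using c by auto
  ultimately show ?thesis using \<C>(1) finite_subset finite_imageD by metis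
qed

end

section \<open>Edges crossing a splitting of the ground space\<close>

context edge_space
begin

lemma edge_point: "e \<in> edges X \<Longrightarrow> t \<in> {0<..<1} \<Longrightarrow> \<gamma> e t \<in> e"
  and edge_pointE: "\<lbrakk>e \<in> edges X; x \<in> e; \<And>t. \<lbrakk>t \<in> {0<..<1}; x = \<gamma> e t\<rbrakk> \<Longrightarrow> thesis\<rbrakk> \<Longrightarrow> thesis"
proof -
  assume "e \<in> edges X"
  then have im: "\<gamma> e ` {0<..<1} = e" using arc_path_edge by (simp add: arc_path_def)
  show "t \<in> {0<..<1} \<Longrightarrow> \<gamma> e t \<in> e" using im by blast
  show "\<lbrakk>x \<in> e; \<And>t. \<lbrakk>t \<in> {0<..<1}; x = \<gamma> e t\<rbrakk> \<Longrightarrow> thesis\<rbrakk> \<Longrightarrow> thesis" using im by blast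
qed

text \<open>Around a point of an edge only that edge is present, since edges are open. Around a
  ground point off \<open>A\<close>, an edge of \<open>E\<close> must extend as far as its ends in
  \<open>A\<close>; it is therefore large, and only finitely many edges are.\<close>

lemma closed_edge_union:
  assumes A: "closed A" "A \<subseteq> ground X" and E: "E \<subseteq> edges X"
    and ends: "\<And>e. e \<in> E \<Longrightarrow> \<gamma> e 0 \<in> A \<and> \<gamma> e 1 \<in> A"
  shows "closed (A \<union> \<Union>E)"
proof -
  let ?T = "A \<union> \<Union>E"
  have TX: "?T \<subseteq> X" using A(2) E edgesD(3) unfolding ground_def by blast
  have "y \<in> ?T" if y: "y \<in> closure ?T" for y
  proof (rule ccontr)
    assume yT: "y \<notin> ?T"
    have yX: "y \<in> X" using y closure_minimal[OF TX compact_imp_closed[OF compact_X]] by blast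
    show False
    proof (cases "\<exists>e\<in>edges X. y \<in> e")
      case True
      then obtain e where e: "e \<in> edges X" "y \<in> e" by blast
      obtain W where W: "open W" "e = X \<inter> W" using edgesD(2)[OF e(1)] by (auto simp: openin_open)
      obtain u where u: "u \<in> ?T" "u \<in> W"
        using y W e(2) closure_iff_nhds_not_empty[of y ?T] by (metis Int_iff disjoint_iff order_refl)
      then have "u \<in> e" using W TX by blast
      then have "e \<in> E" using u(1) A(2) E disjoint_edges[OF e(1)] edge_not_ground[OF e(1)] by blast
      then show False using yT e(2) by blast
    next
      case False
      then have yg: "y \<in> ground X" using yX by (auto simp: ground_def)
      obtain r where r: "0 < r" "ball y r \<subseteq> - A"
        using A(1) yT by (meson ComplI UnI1 open_Compl open_contains_ball)
      let ?G = "{e \<in> E. \<not> small_edge (r/2) e}"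
      have fin: "finite ?G"
        by (rule finite_subset[OF _ finite_large_edges[of "r/2"]]) (use r(1) E in auto)
      have "?T \<subseteq> - ball y (r/2) \<union> (\<Union>e\<in>?G. closure e)"
      proof
        fix u assume u: "u \<in> ?T"
        show "u \<in> - ball y (r/2) \<union> (\<Union>e\<in>?G. closure e)"
        proof (cases "u \<in> ball y (r/2)")
          case True
          then have "u \<in> ball y r" using r(1) by auto
          then obtain e where e: "e \<in> E" "u \<in> e" using r(2) u by blast
          have "\<not> small_edge (r/2) e"
          proof
            assume "small_edge (r/2) e"
            then have "dist u (\<gamma> e 0) < r/2"
              using e E edge_closure(2)[of e] by (auto simp: small_edge_def)
            then have "\<gamma> e 0 \<in> ball y r" using True dist_triangle_half_r by (metis dist_commute mem_ball)
            then show False using r(2) ends[OF e(1)] by blast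
          qed
          then show ?thesis using e closure_subset by blast
        qed simp
      qed
      moreover have "closed (- ball y (r/2) \<union> (\<Union>e\<in>?G. closure e))"
        using fin by (intro closed_Un closed_UN closed_Compl) auto
      ultimately have "y \<in> - ball y (r/2) \<union> (\<Union>e\<in>?G. closure e)"
        using y closure_minimal by blast
      then obtain e where e: "e \<in> E" "y \<in> closure e" using r(1) by auto
      then have "y = \<gamma> e 0 \<or> y = \<gamma> e 1 \<or> y \<in> e" using edge_closure(2)[of e] E by auto
      then show False using ends[OF e(1)] yT e(1) by blast
    qed
  qed
  then show ?thesis using closure_subset_eq by blast
qed

text \<open>If every edge from \<open>A\<close> to \<open>B\<close> had a point outside
  \<open>S\<close>, cutting the edges at these points would extend the splitting of the ground space
  to a splitting of \<open>S\<close>. As \<open>A\<close> and \<open>B\<close> have positive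
  distance, only finitely many edges cross, which keeps both halves closed.\<close>

lemma crossing_edge:
  assumes S: "connected S" "S \<subseteq> X" and A: "closed A" "closed B" "A \<union> B = ground X" "A \<inter> B = {}"
    and z: "z \<in> S" "z \<in> A" "z' \<in> S" "z' \<in> B"
  shows "\<exists>e\<in>edges X. e \<subseteq> S \<and> (\<gamma> e 0 \<in> A \<and> \<gamma> e 1 \<in> B \<or> \<gamma> e 0 \<in> B \<and> \<gamma> e 1 \<in> A)"
proof (rule ccontr)
  assume "\<not> ?thesis"
  then have no: "\<not> e \<subseteq> S" if "e \<in> edges X" "\<gamma> e 0 \<in> A \<and> \<gamma> e 1 \<in> B \<or> \<gamma> e 0 \<in> B \<and> \<gamma> e 1 \<in> A" for e
    using that by blast
  define F where "F = {e \<in> edges X. \<gamma> e 0 \<in> A \<and> \<gamma> e 1 \<in> B \<or> \<gamma> e 0 \<in> B \<and> \<gamma> e 1 \<in> A}"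
  have FE: "F \<subseteq> edges X" by (auto simp: F_def)
  have ab: "\<gamma> e 0 \<in> A \<union> B" "\<gamma> e 1 \<in> A \<union> B" if "e \<in> edges X" for e
    using ends_ground[OF that] A(3) by auto
  obtain d where d: "0 < d" "\<And>x y. \<lbrakk>x \<in> A; y \<in> B\<rbrakk> \<Longrightarrow> d \<le> dist x y"
    using compact_disjoint_gap[OF _ _ A(4)] A compact_ground
    by (metis Un_upper1 Un_upper2 closed_Int_compact inf.absorb1)
  have finF: "finite F"
  proof (rule finite_subset[OF _ finite_large_edges[OF d(1)]])
    show "F \<subseteq> {e \<in> edges X. \<not> small_edge d e}"
      using d(2) edge_closure(2) by (fastforce simp: F_def small_edge_def not_less dist_commute)
  qed
  have "\<exists>m. 0 < m \<and> m < 1 \<and> \<gamma> e m \<notin> S" if eF: "e \<in> F" for e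
  proof -
    have "\<not> e \<subseteq> S" using no eF by (auto simp: F_def)
    then obtain x where x: "x \<in> e" "x \<notin> S" by blast
    obtain t where "t \<in> {0<..<1}" "x = \<gamma> e t" using edge_pointE[of e x] FE eF x(1) by blast
    then show ?thesis using x(2) by auto
  qed
  then obtain m where m: "\<And>e. e \<in> F \<Longrightarrow> 0 < m e \<and> m e < 1 \<and> \<gamma> e (m e) \<notin> S" by metis
  \<comment> \<open>The parameters between the end in \<open>C\<close> and the cut
    \<open>m e\<close>. The two parts of a crossing edge share only the cut point, which is outside
    \<open>S\<close>.\<close>
  define I where "I C e = (if \<gamma> e 0 \<in> C then {0..m e} else {m e..1})" for C e
  define K where "K C = (C \<union> \<Union>{e \<in> edges X - F. \<gamma> e 0 \<in> C}) \<union> (\<Union>e\<in>F. \<gamma> e ` I C e)" for C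
  have cl: "closed (K C)" if C: "C = A \<or> C = B" for C
    unfolding K_def
  proof (intro closed_Un[OF closed_edge_union closed_UN])
    show "closed C" "C \<subseteq> ground X" "{e \<in> edges X - F. \<gamma> e 0 \<in> C} \<subseteq> edges X" "finite F"
      using C A finF by auto
    show "\<And>e. e \<in> {e \<in> edges X - F. \<gamma> e 0 \<in> C} \<Longrightarrow> \<gamma> e 0 \<in> C \<and> \<gamma> e 1 \<in> C"
      using C ab by (auto simp: F_def)
    show "\<forall>e\<in>F. closed (\<gamma> e ` I C e)"
    proof
      fix e assume e: "e \<in> F"
      have "continuous_on {0..1} (\<gamma> e)" using arc_path_edge[of e] FE e by (auto simp: arc_path_def)
      then have "continuous_on (I C e) (\<gamma> e)"
        by (rule continuous_on_subset) (use m[OF e] in \<open>auto simp: I_def\<close>)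
      then have "compact (\<gamma> e ` I C e)"
        by (rule compact_continuous_image) (auto simp: I_def)
      then show "closed (\<gamma> e ` I C e)" by (rule compact_imp_closed)
    qed
  qed
  have inner: "t \<in> {0<..<1}" if "e \<in> F" "t \<in> I C e" "\<gamma> e t \<notin> ground X" for e t C
  proof -
    have "t \<noteq> 0" "t \<noteq> 1" using that FE ends_ground by blast+
    then show ?thesis using that m[of e] by (auto simp: I_def split: if_splits)
  qed
  have sub: "S \<subseteq> K A \<union> K B"
  proof
    fix x assume "x \<in> S"
    then have "x \<in> X" using S by blast
    then consider "x \<in> ground X" | e where "e \<in> edges X" "x \<in> e" by (auto simp: ground_def)
    then show "x \<in> K A \<union> K B"
    proof cases
      case 1
      then show ?thesis using A(3) by (auto simp: K_def)
    next
      case (2 e)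
      show ?thesis
      proof (cases "e \<in> F")
        case False
        then show ?thesis using 2 ab[of e] by (auto simp: K_def)
      next
        case True
        obtain t where t: "t \<in> {0<..<1}" "x = \<gamma> e t"
          using edge_pointE[of e x] 2 by blast
        have "t \<in> I A e \<or> t \<in> I B e"
          using t True A(4) by (auto simp: I_def F_def)
        then show ?thesis using t True by (auto simp: K_def)
      qed
    qed
  qed
  have disj: "K A \<inter> K B \<inter> S = {}"
  proof (rule ccontr)
    assume "K A \<inter> K B \<inter> S \<noteq> {}"
    then obtain x where x: "x \<in> K A" "x \<in> K B" "x \<in> S" by blast
    show False
    proof (cases "x \<in> ground X")
      case True
      have "x \<in> C" if C: "C = A \<or> C = B" and xK: "x \<in> K C" for C
      proof (rule ccontr)
        assume "x \<notin> C"
        then obtain e t where e: "e \<in> F" "x = \<gamma> e t" "t \<in> I C e"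
          using xK edge_not_ground True by (auto simp: K_def)
        have "t \<notin> {0<..<1}"
          using edge_point[of e t] edge_not_ground[of e x] True FE e by blast
        then have "t = 0 \<and> \<gamma> e 0 \<in> C \<or> t = 1 \<and> \<gamma> e 0 \<notin> C"
          using e m[of e] by (auto simp: I_def split: if_splits)
        then have "x \<in> C" using C e A(4) by (auto simp: F_def)
        then show False using \<open>x \<notin> C\<close> by blast
      qed
      then show False using x A(4) by blast
    next
      case False
      then obtain e where e: "e \<in> edges X" "x \<in> e" using x(3) S by (auto simp: ground_def)
      have *: "(e \<notin> F \<and> \<gamma> e 0 \<in> C) \<or> (e \<in> F \<and> x \<in> \<gamma> e ` I C e)"
        if C: "C = A \<or> C = B" and xK: "x \<in> K C" for C
      proof -
        have "x \<notin> C" using False C A(3) by blast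
        then consider e' where "e' \<in> edges X - F" "\<gamma> e' 0 \<in> C" "x \<in> e'" | e' where "e' \<in> F" "x \<in> \<gamma> e' ` I C e'"
          using xK by (auto simp: K_def)
        then show ?thesis
        proof cases
          case (1 e')
          then show ?thesis using disjoint_edges[OF e(1), of e' x] e by auto
        next
          case (2 e')
          then obtain t where t: "x = \<gamma> e' t" "t \<in> I C e'" by blast
          then have "t \<in> {0<..<1}" using inner[of e' t C] 2 False by simp
          moreover have "e' \<in> edges X" using 2 FE by blast
          ultimately have "x \<in> e'" using edge_point[of e' t] t(1) by simp
          then show ?thesis using disjoint_edges[OF e(1), of e' x] e 2 FE by auto
        qed
      qed
      show False
      proof (cases "e \<in> F")
        case False
        then show False using *[of A] *[of B] x A(4) by blast
      next
        case True
        obtain s t where st: "s \<in> I A e" "t \<in> I B e" "x = \<gamma> e s" "x = \<gamma> e t"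
          using *[of A] *[of B] x True by blast
        then have st': "s \<in> {0<..<1}" "t \<in> {0<..<1}"
          using inner[OF True st(1)] inner[OF True st(2)] False by simp_all
        have "inj_on (\<gamma> e) {0<..<1}" using arc_path_edge[OF e(1)] by (simp add: arc_path_def)
        then have "s = t" by (rule inj_onD) (use st st' in auto)
        then have "s = m e" using st True A(4) by (auto simp: I_def F_def split: if_splits)
        then show False using m[OF True] st x by auto
      qed
    qed
  qed
  show False
    using connected_closed[of S] S(1) cl[of A] cl[of B] sub disj z by (auto simp: K_def)
qed

end

section \<open>Product coordinates on the ground space and short links between copies of
  \<open>P\<close>\<close>

locale product_ground = edge_space +
  fixes V :: "'b::metric_space set" and P :: "'c::metric_space set"
    and h :: "'a \<Rightarrow> 'b \<times> 'c" and k :: "'b \<times> 'c \<Rightarrow> 'a"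
  assumes compact_V: "compact V" and zero_dim_V: "zero_dimensional V"
    and peano_P: "peano_continuum P" and nondeg: "\<exists>p\<in>P. \<exists>q\<in>P. p \<noteq> q"
    and hom: "homeomorphism (ground X) (V \<times> P) h k"
begin

definition vc :: "'a \<Rightarrow> 'b" where "vc x = fst (h x)"
definition pc :: "'a \<Rightarrow> 'c" where "pc x = snd (h x)"

lemma k_ground: "\<lbrakk>v \<in> V; p \<in> P\<rbrakk> \<Longrightarrow> k (v, p) \<in> ground X"
  and vc_k: "\<lbrakk>v \<in> V; p \<in> P\<rbrakk> \<Longrightarrow> vc (k (v, p)) = v"
  and pc_k: "\<lbrakk>v \<in> V; p \<in> P\<rbrakk> \<Longrightarrow> pc (k (v, p)) = p"
  using hom by (auto simp: homeomorphism_def vc_def pc_def)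

lemma coords:
  assumes "x \<in> ground X"
  shows "vc x \<in> V" "pc x \<in> P" "k (vc x, pc x) = x"
proof -
  have "h x \<in> V \<times> P" "k (h x) = x" using hom assms by (auto simp: homeomorphism_def)
  then show "vc x \<in> V" "pc x \<in> P" "k (vc x, pc x) = x" by (auto simp: vc_def pc_def)
qed

lemma cont_h: "continuous_on (ground X) h" and cont_k: "continuous_on (V \<times> P) k"
  using hom by (auto simp: homeomorphism_def)

lemma compact_P: "compact P" and connected_P: "connected P" and lc_P: "locally connected P"
  using peano_P by (auto simp: peano_continuum_def)

lemma ground_in_X: "ground X \<subseteq> X" by (auto simp: ground_def)

text \<open>Coordinates are controlled on \<open>closure S\<close> rather than on \<open>S\<close>,
  because an edge contained in \<open>S\<close> is only known to have its ends in the
  closure.\<close>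

definition links :: "real \<Rightarrow> real \<Rightarrow> bool" where
  "links \<rho> t \<longleftrightarrow> (\<forall>v\<in>V. \<forall>w\<in>V. \<forall>c\<in>P. dist v w < t \<longrightarrow>
     (\<exists>S. connected S \<and> S \<subseteq> X \<and> k (v, c) \<in> S \<and> k (w, c) \<in> S \<and> S \<subseteq> ball (k (v, c)) \<rho> \<and>
       (\<forall>x\<in>closure S \<inter> ground X. dist (vc x) v < \<rho> \<and> dist (pc x) c < \<rho>)))"

text \<open>Uniform continuity of \<open>k\<close> brings the two points close in \<open>X\<close>,
  uniform local connectedness joins them in a small ball, and uniform continuity of \<open>h\<close>
  translates the ball back into coordinates.\<close>

lemma links_exists:
  assumes "0 < \<rho>"
  shows "\<exists>t>0. links \<rho> t"
proof -
  have "uniformly_continuous_on (ground X) h"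
    using compact_uniformly_continuous cont_h compact_ground by blast
  then obtain d1 where d1: "0 < d1" "\<And>x y. \<lbrakk>x \<in> ground X; y \<in> ground X; dist y x < d1\<rbrakk> \<Longrightarrow> dist (h y) (h x) < \<rho>"
    using assms unfolding uniformly_continuous_on_def by metis
  \<comment> \<open>Strictly below \<open>d1\<close>, since \<open>closure S\<close> is only known
    to lie in the closed ball of radius \<open>e\<close>.\<close>
  define e where "e = min d1 \<rho> / 2"
  have e: "0 < e" "e < d1" "e < \<rho>" using d1(1) assms by (auto simp: e_def)
  obtain d where d: "0 < d"
    "\<And>x y. \<lbrakk>x \<in> X; y \<in> X; dist x y < d\<rbrakk> \<Longrightarrow> \<exists>C. connected C \<and> C \<subseteq> X \<and> x \<in> C \<and> y \<in> C \<and> C \<subseteq> ball x e"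
    by (rule uniformly_locally_connected[OF compact_X lc_X e(1)], rule that)
  have "uniformly_continuous_on (V \<times> P) k"
    using compact_uniformly_continuous cont_k compact_Times compact_V compact_P by blast
  then obtain t where t: "0 < t" "\<And>x y. \<lbrakk>x \<in> V \<times> P; y \<in> V \<times> P; dist y x < t\<rbrakk> \<Longrightarrow> dist (k y) (k x) < d"
    using d(1) unfolding uniformly_continuous_on_def by metis
  have "links \<rho> t"
    unfolding links_def
  proof (intro ballI impI)
    fix v w c assume vw: "v \<in> V" "w \<in> V" "c \<in> P" "dist v w < t"
    let ?z = "k (v, c)"
    have "dist (v, c) (w, c) < t" using vw by (simp add: dist_Pair_Pair)
    then have "dist ?z (k (w, c)) < d" using t(2) vw by simp
    moreover have "?z \<in> X" "k (w, c) \<in> X"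
      using k_ground[OF vw(1,3)] k_ground[OF vw(2,3)] ground_in_X by auto
    ultimately have "\<exists>S. connected S \<and> S \<subseteq> X \<and> ?z \<in> S \<and> k (w, c) \<in> S \<and> S \<subseteq> ball ?z e"
      by (intro d(2))
    then obtain S where S: "connected S" "S \<subseteq> X" "?z \<in> S" "k (w, c) \<in> S" "S \<subseteq> ball ?z e" by metis
    have "dist (vc x) v < \<rho> \<and> dist (pc x) c < \<rho>" if x: "x \<in> closure S" "x \<in> ground X" for x
    proof -
      have "closure S \<subseteq> cball ?z e" by (rule closure_minimal) (use S(5) in \<open>auto simp: subset_iff less_imp_le\<close>)
      then have "dist x ?z < d1" using x(1) e by (auto simp: dist_commute)
      then have "dist (h x) (h ?z) < \<rho>" using d1(2) x(2) k_ground[OF vw(1,3)] by blast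
      moreover have "h ?z = (v, c)" using vc_k[OF vw(1,3)] pc_k[OF vw(1,3)] by (simp add: vc_def pc_def prod_eq_iff)
      ultimately show ?thesis
        using dist_fst_le[of "h x" "(v, c)"] dist_snd_le[of "h x" "(v, c)"] by (simp add: vc_def pc_def)
    qed
    moreover have "S \<subseteq> ball ?z \<rho>" using S(5) e by (auto simp: subset_iff)
    ultimately show "\<exists>S. connected S \<and> S \<subseteq> X \<and> ?z \<in> S \<and> k (w, c) \<in> S \<and> S \<subseteq> ball ?z \<rho> \<and>
       (\<forall>x\<in>closure S \<inter> ground X. dist (vc x) v < \<rho> \<and> dist (pc x) c < \<rho>)"
      using S by blast
  qed
  then show ?thesis using t(1) by blast
qed

end

section \<open>Colouring the edges\<close>

text \<open>A connected set with more than one point has no isolated points, so it stays dense in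
  itself after the removal of finitely many points.\<close>

lemma finite_net_avoiding:
  fixes P :: "'a::metric_space set"
  assumes "compact P" "connected P" "\<exists>p\<in>P. \<exists>q\<in>P. p \<noteq> q" "finite F" "0 < e"
  obtains D where "finite D" "D \<subseteq> P - F" "\<And>p. p \<in> P \<Longrightarrow> \<exists>c\<in>D. dist p c < e"
proof -
  have "\<exists>c\<in>P - F. p \<in> ball c e" if p: "p \<in> P" for p
  proof -
    have "p islimpt P" using connected_imp_perfect[OF assms(2) p] assms(3) by force
    then have "infinite (P \<inter> ball p e)" using assms(5) islimpt_eq_infinite_ball by blast
    then have "\<not> P \<inter> ball p e \<subseteq> F" using assms(4) finite_subset by blast
    then show ?thesis by (auto simp: dist_commute)
  qed
  then have "P \<subseteq> (\<Union>c\<in>P - F. ball c e)" by auto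
  then obtain D where "D \<subseteq> P - F" "finite D" "P \<subseteq> (\<Union>c\<in>D. ball c e)"
    using compactE_image[OF assms(1), of "P - F" "\<lambda>c. ball c e"] by auto
  moreover have "\<exists>c\<in>D. dist p c < e" if "p \<in> P" for p
    using subsetD[OF \<open>P \<subseteq> (\<Union>c\<in>D. ball c e)\<close> that] by (auto simp: dist_commute)
  ultimately show thesis using that[of D] by blast
qed

text \<open>Dependent choice lets each level avoid the one before. Disjointness at neighbouring
  levels suffices, because the gap of an edge determines its level up to one.\<close>

lemma two_coloured_nets:
  fixes P :: "'a::metric_space set"
  assumes P: "compact P" "connected P" "\<exists>p\<in>P. \<exists>q\<in>P. p \<noteq> q"
  obtains D :: "nat \<Rightarrow> bool \<Rightarrow> 'a set" where "\<And>n i. finite (D n i)" "\<And>n i. D n i \<subseteq> P"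
    "\<And>n i p. p \<in> P \<Longrightarrow> \<exists>c\<in>D n i. dist p c < 1 / (real n + 1)"
    "\<And>m n i. \<lbrakk>m \<le> n + 1; n \<le> m + 1\<rbrakk> \<Longrightarrow> D m i \<inter> D n (\<not> i) = {}"
proof -
  define Q where "Q n s \<longleftrightarrow> (\<forall>i. finite (s i) \<and> s i \<subseteq> P \<and> (\<forall>p\<in>P. \<exists>c\<in>s i. dist p c < 1 / (real n + 1)))
     \<and> s True \<inter> s False = {}" for n :: nat and s :: "bool \<Rightarrow> 'a set"
  have step: "\<exists>s. Q n s \<and> (\<forall>i. s i \<inter> F = {})" if F: "finite F" for n F
  proof -
    have e: "0 < 1 / (real n + 1)" by simp
    obtain D1 where D1: "finite D1" "D1 \<subseteq> P - F" "\<And>p. p \<in> P \<Longrightarrow> \<exists>c\<in>D1. dist p c < 1 / (real n + 1)"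
      using finite_net_avoiding[OF P F e] by metis
    have F': "finite (F \<union> D1)" using F D1 by simp
    obtain D2 where D2: "finite D2" "D2 \<subseteq> P - (F \<union> D1)" "\<And>p. p \<in> P \<Longrightarrow> \<exists>c\<in>D2. dist p c < 1 / (real n + 1)"
      using finite_net_avoiding[OF P F' e] by metis
    show ?thesis
      by (rule exI[of _ "\<lambda>i. if i then D1 else D2"]) (use D1 D2 in \<open>auto simp: Q_def\<close>)
  qed
  have "\<exists>D. \<forall>n. Q n (D n) \<and> (\<forall>i j. D n i \<inter> D (Suc n) j = {})"
  proof (rule dependent_nat_choice)
    show "\<exists>s. Q 0 s" using step[of "{}"] by auto
    fix s n assume "Q n s"
    then have "finite (s True \<union> s False)" by (simp add: Q_def)
    then obtain s' where s': "Q (Suc n) s'" "\<forall>j. s' j \<inter> (s True \<union> s False) = {}" using step by blast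
    have "s i \<inter> s' j = {}" for i j using s'(2) by (cases i) auto
    then show "\<exists>s'. Q (Suc n) s' \<and> (\<forall>i j. s i \<inter> s' j = {})" using s' by blast
  qed
  then obtain D where D: "\<And>n. Q n (D n)" "\<And>n i j. D n i \<inter> D (Suc n) j = {}" by blast
  show thesis
  proof (rule that[of D])
    fix m n :: nat and i assume "m \<le> n + 1" "n \<le> m + 1"
    then consider "m = n" | "m = Suc n" | "n = Suc m" by linarith
    then show "D m i \<inter> D n (\<not> i) = {}"
    proof cases
      case 1
      then show ?thesis using D(1)[of n] by (cases i) (auto simp: Q_def)
    next
      case 2
      then show ?thesis using D(2)[of n "\<not> i" i] by auto
    next
      case 3
      then show ?thesis using D(2)[of m i "\<not> i"] by auto
    qed
  qed (use D(1) in \<open>auto simp: Q_def\<close>)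
qed

lemma separated_radii:
  fixes D :: "nat \<Rightarrow> bool \<Rightarrow> 'a::metric_space set"
  assumes fin: "\<And>n i. finite (D n i)"
    and disj: "\<And>m n i. \<lbrakk>m \<le> n + 1; n \<le> m + 1\<rbrakk> \<Longrightarrow> D m i \<inter> D n (\<not> i) = {}"
  obtains r :: "nat \<Rightarrow> real" where "\<And>n. 0 < r n" "\<And>n. r n < 1 / (real n + 1)"
    "\<And>m n i c c'. \<lbrakk>m \<le> n + 1; n \<le> m + 1; c \<in> D m True; c' \<in> D n False\<rbrakk> \<Longrightarrow> r m + r n \<le> dist c c'"
proof -
  have "\<exists>r>0. r < 1 / (real m + 1) \<and>
    (\<forall>n i. m \<le> n + 1 \<and> n \<le> m + 1 \<longrightarrow> (\<forall>c\<in>D m i. \<forall>c'\<in>D n (\<not> i). 2 * r \<le> dist c c'))" for m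
  proof -
    define \<Delta> where "\<Delta> = (\<Union>n\<in>{n. m \<le> n + 1 \<and> n \<le> m + 1}. \<Union>i\<in>UNIV. (\<lambda>(c, c'). dist c c') ` (D m i \<times> D n (\<not> i)))"
    have "finite {n. m \<le> n + 1 \<and> n \<le> m + 1}" by (rule finite_subset[of _ "{..m+1}"]) auto
    then have fin\<Delta>: "finite \<Delta>" unfolding \<Delta>_def using fin by auto
    have pos: "0 < x" if "x \<in> \<Delta>" for x
      using that disj unfolding \<Delta>_def by (auto simp del: dist_commute) blast
    \<comment> \<open>Half of the least distance to an opposite net at a neighbouring level, so that
      two such radii add up to at most that distance. The inserted value makes the minimum well
      defined and bounds \<open>r\<close>.\<close>
    define r where "r = Min (insert (1 / (real m + 1)) \<Delta>) / 2"
    have "0 < Min (insert (1 / (real m + 1)) \<Delta>)"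
      by (subst Min_gr_iff) (use fin\<Delta> pos in auto)
    moreover have "2 * r \<le> x" if "x \<in> insert (1 / (real m + 1)) \<Delta>" for x
      using Min_le[OF _ that] fin\<Delta> by (simp add: r_def)
    moreover have "2 * r \<le> 1 / (real m + 1)" using calculation(2) by blast
    moreover have "0 < 1 / (real m + 1)" by simp
    moreover have "dist c c' \<in> \<Delta>" if "m \<le> n + 1" "n \<le> m + 1" "c \<in> D m i" "c' \<in> D n (\<not> i)" for n i c c'
      using that unfolding \<Delta>_def by blast
    ultimately have "0 < r" "r < 1 / (real m + 1)"
      "\<forall>n i. m \<le> n + 1 \<and> n \<le> m + 1 \<longrightarrow> (\<forall>c\<in>D m i. \<forall>c'\<in>D n (\<not> i). 2 * r \<le> dist c c')"
      by (simp add: r_def, linarith, blast)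
    then show ?thesis by blast
  qed
  then obtain r where r: "\<And>m. 0 < r m" "\<And>m. r m < 1 / (real m + 1)"
    "\<And>m n i c c'. \<lbrakk>m \<le> n + 1; n \<le> m + 1; c \<in> D m i; c' \<in> D n (\<not> i)\<rbrakk> \<Longrightarrow> 2 * r m \<le> dist c c'"
    by metis
  have "r m + r n \<le> dist c c'" if "m \<le> n + 1" "n \<le> m + 1" "c \<in> D m True" "c' \<in> D n False" for m n c c'
    using r(3)[of m n c True c'] r(3)[of n m c' False c] that by (auto simp: dist_commute)
  then show thesis using that[of r] r by blast
qed

context product_ground
begin

lemma in_slab_iff:
  assumes "x \<in> ground X" "C \<subseteq> V"
  shows "x \<in> k ` (C \<times> P) \<longleftrightarrow> vc x \<in> C"
proof
  assume "x \<in> k ` (C \<times> P)"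
  then obtain v p where vp: "v \<in> C" "p \<in> P" "x = k (v, p)" by blast
  then have "v \<in> V" using assms(2) by blast
  then show "vc x \<in> C" using vc_k[OF _ vp(2)] vp by simp
next
  assume "vc x \<in> C"
  then have "k (vc x, pc x) \<in> k ` (C \<times> P)" using coords(2)[OF assms(1)] by blast
  then show "x \<in> k ` (C \<times> P)" using coords(3)[OF assms(1)] by simp
qed

text \<open>Each scale is chosen after the previous one. A link across a distance below
  \<open>t (Suc n)\<close> stays within \<open>t n / 2\<close> in \<open>V\<close>, so the ends of
  an edge inside it are less than \<open>t n\<close> apart there. Halving at every step makes the
  scales tend to 0.\<close>

lemma scales_exist:
  assumes "\<And>n. 0 < r n"
  obtains t :: "nat \<Rightarrow> real" where "\<And>n. 0 < t n" "\<And>n. t (Suc n) < t n"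
    "\<And>n. links (min (r (Suc n)) (t n / 2)) (t (Suc n))" "\<And>d. 0 < d \<Longrightarrow> \<exists>n. t n < d"
proof -
  have "\<exists>t. \<forall>n. 0 < t n \<and> (t (Suc n) < t n / 2 \<and> links (min (r (Suc n)) (t n / 2)) (t (Suc n)))"
  proof (rule dependent_nat_choice)
    show "\<exists>x::real. 0 < x" by (rule exI[of _ 1]) simp
    fix x :: real and n assume x: "0 < x"
    then have "0 < min (r (Suc n)) (x / 2)" using assms by simp
    then obtain s where s: "0 < s" "links (min (r (Suc n)) (x / 2)) s" using links_exists by blast
    have "links (min (r (Suc n)) (x / 2)) (min s (x / 3))" using s(2) unfolding links_def by simp
    then show "\<exists>y. 0 < y \<and> (y < x / 2 \<and> links (min (r (Suc n)) (x / 2)) y)"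
      using s(1) x by (intro exI[of _ "min s (x / 3)"]) auto
  qed
  then obtain t where t: "\<And>n. 0 < t n" "\<And>n. t (Suc n) < t n / 2"
    "\<And>n. links (min (r (Suc n)) (t n / 2)) (t (Suc n))" by blast
  have bd: "t n \<le> t 0 * (1/2) ^ n" for n
  proof (induction n)
    case (Suc n)
    then show ?case using t(2)[of n] by simp
  qed simp
  show thesis
  proof (rule that[of t])
    show "t (Suc n) < t n" for n using t(1)[of n] t(2)[of n] by linarith
    fix d :: real assume "0 < d"
    then obtain n where "(1/2) ^ n < d / t 0" using real_arch_pow_inv[of "d / t 0" "1/2"] t(1)[of 0] by auto
    then have "t 0 * (1/2) ^ n < d" using t(1)[of 0] by (simp add: field_simps)
    then show "\<exists>n. t n < d" using bd[of n] by (intro exI[of _ n]) linarith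
  qed (use t in auto)
qed

end

text \<open>An edge is coloured by the place where it leaves the first copy of \<open>P\<close>, measured at a scale
  given by the distance in \<open>V\<close> between the two copies it joins. Nets belonging to different colours
  are disjoint at neighbouring scales, so the two colours exclude each other.\<close>

locale coloured = product_ground X V P h k
  for X :: "'a::metric_space set" and V :: "'b::metric_space set" and P :: "'c::metric_space set" and h k +
  fixes D :: "nat \<Rightarrow> bool \<Rightarrow> 'c set" and r t :: "nat \<Rightarrow> real"
  assumes D_P: "\<And>n i. D n i \<subseteq> P"
    and D_net: "\<And>n i p. p \<in> P \<Longrightarrow> \<exists>c\<in>D n i. dist p c < 1 / (real n + 1)"
    and r_pos: "\<And>n. 0 < r n" and r_small: "\<And>n. r n < 1 / (real n + 1)"
    and r_sep: "\<And>m n i c c'. \<lbrakk>m \<le> n + 1; n \<le> m + 1; c \<in> D m True; c' \<in> D n False\<rbrakk> \<Longrightarrow> r m + r n \<le> dist c c'"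
    and t_pos: "\<And>n. 0 < t n" and t_dec: "\<And>n. t (Suc n) < t n"
    and t_links: "\<And>n. links (min (r (Suc n)) (t n / 2)) (t (Suc n))"
    and t_lim: "\<And>d. 0 < d \<Longrightarrow> \<exists>n. t n < d"
begin

definition gap :: "'a set \<Rightarrow> real" where "gap e = dist (vc (\<gamma> e 0)) (vc (\<gamma> e 1))"

text \<open>The window spans two steps to absorb the loss in a link: a splitting with minimal
  distance at least \<open>t (n + 2)\<close> and below \<open>t (n + 1)\<close> yields an edge whose
  gap is no smaller but may grow up to \<open>t n\<close>. Testing the arbitrarily chosen end
  \<open>\<gamma> e 0\<close> is harmless, as both ends of the edges found in
  \<open>cut_edge\<close> are near the same net point.\<close>

definition colour :: "bool \<Rightarrow> 'a set set" where
  "colour i = {e \<in> edges X. \<exists>n. \<exists>c\<in>D (Suc n) i.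
     dist (pc (\<gamma> e 0)) c < r (Suc n) \<and> t (n + 2) \<le> gap e \<and> gap e < t n}"

lemma t_mono: "m \<le> n \<Longrightarrow> t n \<le> t m"
  using lift_Suc_antimono_le[of t] t_dec less_imp_le by metis

lemma colour_disjoint: "colour True \<inter> colour False = {}"
proof (rule ccontr)
  assume "colour True \<inter> colour False \<noteq> {}"
  then obtain e m n c c' where
    m: "c \<in> D (Suc m) True" "dist (pc (\<gamma> e 0)) c < r (Suc m)" "t (m + 2) \<le> gap e" "gap e < t m" and
    n: "c' \<in> D (Suc n) False" "dist (pc (\<gamma> e 0)) c' < r (Suc n)" "t (n + 2) \<le> gap e" "gap e < t n"
    by (auto simp: colour_def)
  \<comment> \<open>Windows of levels two or more apart are disjoint: the lower bound
    \<open>t (m + 2)\<close> of one is at least the upper bound \<open>t n\<close> of the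
    other.\<close>
  have "n < m + 2" using t_mono[of "m + 2" n] m n by (meson leI le_less_trans not_le)
  moreover have "m < n + 2" using t_mono[of "n + 2" m] m n by (meson leI le_less_trans not_le)
  ultimately have "r (Suc m) + r (Suc n) \<le> dist c c'" using r_sep m n by simp
  then show False using m(2) n(2) dist_triangle3[of c c' "pc (\<gamma> e 0)"] by linarith
qed

lemma colour_gap_pos:
  assumes "e \<in> colour i"
  shows "0 < gap e"
proof -
  obtain n where "t (n + 2) \<le> gap e" using assms by (auto simp: colour_def)
  then show ?thesis using t_pos[of "n + 2"] by linarith
qed

text \<open>\<open>\<delta>\<close> does not depend on the splitting, which becomes known only after
  a nearby point is given. The points \<open>v0\<close> and \<open>w\<close> only make the minimal
  distance of \<open>VA\<close> and \<open>VB\<close> small; the edge is found over a nearest pair,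
  wherever in \<open>W\<close> that lies, at a net point of colour \<open>i\<close> close to
  \<open>p0\<close>.\<close>

lemma cut_edge:
  assumes v0: "v0 \<in> V" and p0: "p0 \<in> P" and \<beta>: "0 < \<beta>"
    and W: "openin (top_of_set V) W" "closedin (top_of_set V) W" "v0 \<in> W"
  obtains \<delta> where "0 < \<delta>"
    "\<And>VA VB w. \<lbrakk>compact VA; compact VB; VA \<union> VB = W; VA \<inter> VB = {}; v0 \<in> VA; w \<in> VB; dist v0 w < \<delta>\<rbrakk>
      \<Longrightarrow> \<exists>e\<in>colour i. small_edge \<beta> e \<and> (\<exists>a b. {a, b} = {\<gamma> e 0, \<gamma> e 1} \<and>
        vc a \<in> VA \<and> vc b \<in> VB \<and> dist (pc a) p0 < \<beta> \<and> dist (pc b) p0 < \<beta>)"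
proof -
  have WV: "W \<subseteq> V" using W(1) openin_imp_subset by blast
  have cW: "compact W" "compact (V - W)"
    using W compact_V closedin_compact openin_closedin_eq by (auto simp: openin_closedin_eq)
  obtain d where d: "0 < d" "\<And>x y. \<lbrakk>x \<in> W; y \<in> V - W\<rbrakk> \<Longrightarrow> d \<le> dist x y"
    using compact_disjoint_gap[OF cW] by blast
  obtain K1 where K1: "t K1 < d" using t_lim[OF d(1)] by blast
  obtain K2 :: nat where K2: "2 / \<beta> < real K2" using reals_Archimedean2 by blast
  \<comment> \<open>From level \<open>K\<close> on, links are too short to leave \<open>W\<close>,
    and the net mesh plus the radius stays below \<open>\<beta>\<close>.\<close>
  define K where "K = max K1 K2"
  have tK: "t n < d" if "K \<le> n" for n using t_mono[of K1 n] K1 that by (simp add: K_def)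
  have bK: "2 / (real n + 2) < \<beta>" if "K \<le> n" for n
  proof -
    have "2 / \<beta> < real n + 2" using K2 that by (simp add: K_def)
    then show ?thesis using \<beta> by (simp add: field_simps)
  qed
  show thesis
  proof (rule that[of "t (Suc K)"])
    show "0 < t (Suc K)" by (rule t_pos)
    fix VA VB w
    assume A: "compact VA" "compact VB" "VA \<union> VB = W" "VA \<inter> VB = {}" "v0 \<in> VA" "w \<in> VB" "dist v0 w < t (Suc K)"
    obtain v' w' where vw: "v' \<in> VA" "w' \<in> VB" "\<And>x y. \<lbrakk>x \<in> VA; y \<in> VB\<rbrakk> \<Longrightarrow> dist v' w' \<le> dist x y"
      using compact_nearest_pair[OF A(1,2)] A(5,6) by blast
    define g where "g = dist v' w'"
    have "v' \<noteq> w'" using vw A(4) by blast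
    then have g0: "0 < g" by (simp add: g_def)
    have gK: "g < t (Suc K)" using vw(3)[OF A(5,6)] A(7) by (simp add: g_def)
    \<comment> \<open>The first level with \<open>t N \<le> g\<close>. The index used is
      \<open>n = N - 2\<close>: then \<open>g < t (Suc n)\<close> permits a link, and
      \<open>n\<close> is still at least \<open>K\<close>.\<close>
    define N where "N = (LEAST n. t n \<le> g)"
    obtain n0 where "t n0 < g" using t_lim[OF g0] by blast
    then have N1: "t N \<le> g" unfolding N_def using LeastI[of "\<lambda>n. t n \<le> g" n0] by simp
    have N2: "\<not> t n \<le> g" if "n < N" for n using not_less_Least[of n "\<lambda>n. t n \<le> g"] that by (simp add: N_def)
    have "Suc K < N"
    proof (rule ccontr)
      assume "\<not> Suc K < N"
      then have "t (Suc K) \<le> t N" using t_mono by simp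
      then show False using N1 gK by linarith
    qed
    then obtain n where n: "N = n + 2" "K \<le> n"
      using that[of "N - 2"] by simp
    have g1: "t (n + 2) \<le> g" "g < t (Suc n)" using N1 N2[of "Suc n"] n by (auto simp: not_le)
    obtain c where c: "c \<in> D (Suc n) i" "dist p0 c < 1 / (real (Suc n) + 1)" using D_net[OF p0] by blast
    then have cP: "c \<in> P" using D_P by blast
    have vV: "v' \<in> V" "w' \<in> V" using vw A(3) WV by auto
    let ?\<rho> = "min (r (Suc n)) (t n / 2)" and ?z = "k (v', c)"
    have "dist v' w' < t (Suc n)" using g1(2) by (simp add: g_def)
    note t_links[of n, unfolded links_def, rule_format, OF vV cP this]
    then obtain S where SS: "connected S \<and> S \<subseteq> X \<and> ?z \<in> S \<and> k (w', c) \<in> S \<and> S \<subseteq> ball ?z ?\<rho> \<and>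
       (\<forall>x\<in>closure S \<inter> ground X. dist (vc x) v' < ?\<rho> \<and> dist (pc x) c < ?\<rho>)" by (rule exE)
    then have S: "connected S" "S \<subseteq> X" "?z \<in> S" "k (w', c) \<in> S" "S \<subseteq> ball ?z ?\<rho>"
      by - (elim conjE, assumption)+
    have near: "dist (vc x) v' < ?\<rho> \<and> dist (pc x) c < ?\<rho>" if "x \<in> closure S" "x \<in> ground X" for x
      using SS that by (elim conjE) (rule bspec, assumption, simp)
    \<comment> \<open>\<open>crossing_edge\<close> requires a splitting of the whole ground space,
      so the part over \<open>V - W\<close> joins the side of \<open>VB\<close>; the distance
      \<open>d\<close> excludes it afterwards.\<close>
    let ?A = "k ` (VA \<times> P)" and ?B = "k ` ((VB \<union> (V - W)) \<times> P)"
    have cl: "closed (k ` (C \<times> P))" if "compact C" "C \<subseteq> V" for C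
    proof (rule compact_imp_closed, rule compact_continuous_image)
      show "continuous_on (C \<times> P) k" using cont_k by (rule continuous_on_subset) (use that in auto)
      show "compact (C \<times> P)" using that compact_P compact_Times by blast
    qed
    have subs: "VA \<subseteq> V" "VB \<union> (V - W) \<subseteq> V" using A(3) WV by auto
    have "compact (VB \<union> (V - W))" using A(2) cW by (intro compact_Un)
    note clAB = cl[OF A(1) subs(1)] cl[OF this subs(2)]
    have memA: "x \<in> ?A \<longleftrightarrow> vc x \<in> VA" if "x \<in> ground X" for x
      by (rule in_slab_iff[OF that subs(1)])
    have memB: "x \<in> ?B \<longleftrightarrow> vc x \<in> VB \<union> (V - W)" if "x \<in> ground X" for x
      by (rule in_slab_iff[OF that subs(2)])
    have inG: "?A \<subseteq> ground X" "?B \<subseteq> ground X" using k_ground subs by auto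
    have un: "?A \<union> ?B = ground X"
    proof -
      have "x \<in> ?A \<union> ?B" if x: "x \<in> ground X" for x
        using memA[OF x] memB[OF x] coords(1)[OF x] A(3) by blast
      then show ?thesis using inG by blast
    qed
    have di: "?A \<inter> ?B = {}"
    proof -
      have "\<not> (x \<in> ?A \<and> x \<in> ?B)" if x: "x \<in> ground X" for x
        using memA[OF x] memB[OF x] A(3,4) by blast
      then show ?thesis using inG by blast
    qed
    obtain e where e: "e \<in> edges X" "e \<subseteq> S" "\<gamma> e 0 \<in> ?A \<and> \<gamma> e 1 \<in> ?B \<or> \<gamma> e 0 \<in> ?B \<and> \<gamma> e 1 \<in> ?A"
      using crossing_edge[OF S(1,2) clAB un di S(3) _ S(4)] vw cP by blast
    then obtain a b where ab: "{a, b} = {\<gamma> e 0, \<gamma> e 1}" "a \<in> ?A" "b \<in> ?B" by auto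
    have ab': "a \<in> closure S" "b \<in> closure S" "a \<in> ground X" "b \<in> ground X"
      using ab edge_closure(2)[OF e(1)] ends_ground[OF e(1)] closure_mono[OF e(2)]
      by (auto simp: doubleton_eq_iff)
    have va: "vc a \<in> VA" using memA[OF ab'(3)] ab(2) by blast
    have nb: "dist (vc b) v' < t n / 2" "dist (vc a) v' < t n / 2" "dist (pc a) c < r (Suc n)" "dist (pc b) c < r (Suc n)"
      using near[OF ab'(1,3)] near[OF ab'(2,4)] by auto
    have "vc b \<in> W"
    proof (rule ccontr)
      assume "vc b \<notin> W"
      then have "d \<le> dist v' (vc b)" using d(2) coords(1)[OF ab'(4)] vw(1) A(3) by blast
      then show False using nb(1) tK[OF n(2)] d(1) by (simp add: dist_commute)
    qed
    then have vb: "vc b \<in> VB" using memB[OF ab'(4)] ab(3) by blast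
    have sp: "gap e = dist (vc a) (vc b)"
      using ab(1) by (auto simp: gap_def doubleton_eq_iff dist_commute)
    \<comment> \<open>Minimality of the pair yields the lower end of the window, closeness of both
      ends to \<open>v'\<close> the upper one.\<close>
    have "g \<le> gap e" using vw(3)[OF va vb] sp by (simp add: g_def)
    moreover have "gap e < t n" using sp nb dist_triangle2[of "vc a" "vc b" v'] by linarith
    moreover have "dist (pc (\<gamma> e 0)) c < r (Suc n)" using nb ab(1) by (auto simp: doubleton_eq_iff)
    ultimately have col: "e \<in> colour i" using e(1) c(1) g1 unfolding colour_def by force
    have r1: "r (Suc n) < 1 / (real n + 2)" using r_small[of "Suc n"] by (simp add: add.commute)
    have c1: "dist p0 c < 1 / (real n + 2)" using c(2) by (simp add: add.commute)
    have b1: "1 / (real n + 2) + 1 / (real n + 2) < \<beta>" using bK[OF n(2)] by simp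
    have "dist x y < \<beta>" if "x \<in> closure e" "y \<in> closure e" for x y
    proof -
      have "closure S \<subseteq> cball ?z (r (Suc n))"
        by (rule closure_minimal) (use S(5) in \<open>auto simp: subset_iff less_imp_le\<close>)
      then have "dist ?z x \<le> r (Suc n)" "dist ?z y \<le> r (Suc n)" using that closure_mono[OF e(2)] by auto
      then show ?thesis using dist_triangle3[of x y ?z] r1 b1 by linarith
    qed
    then have "small_edge \<beta> e" by (simp add: small_edge_def)
    moreover have "dist (pc a) p0 < \<beta>" "dist (pc b) p0 < \<beta>"
      using nb c1 r1 b1 dist_triangle2[of "pc a" p0 c] dist_triangle2[of "pc b" p0 c] by linarith+
    ultimately show "\<exists>e\<in>colour i. small_edge \<beta> e \<and> (\<exists>a b. {a, b} = {\<gamma> e 0, \<gamma> e 1} \<and>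
        vc a \<in> VA \<and> vc b \<in> VB \<and> dist (pc a) p0 < \<beta> \<and> dist (pc b) p0 < \<beta>)"
      using col ab(1) va vb by blast
  qed
qed

end

section \<open>Local connectedness\<close>

context coloured
begin

text \<open>A splitting of the compact neighbourhood \<open>N\<close> between \<open>x\<close> and
  \<open>y\<close> puts each connected slice \<open>L u\<close> on one side and thereby splits
  \<open>W\<close>. The edge of colour \<open>i\<close> given by \<open>cut_edge\<close> joins
  slices on opposite sides, yet its closure is connected and stays in \<open>N\<close>.\<close>

lemma colour_connects_ground:
  assumes E: "colour i \<subseteq> E" "E \<subseteq> edges X" and x: "x \<in> ground X" and \<epsilon>: "0 < \<epsilon>"
  obtains \<delta> where "0 < \<delta>" "\<And>y. \<lbrakk>y \<in> ground X; dist y x < \<delta>\<rbrakk> \<Longrightarrow>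
    \<exists>c. connected c \<and> c \<subseteq> (ground X \<union> \<Union>E) \<inter> ball x \<epsilon> \<and> x \<in> c \<and> y \<in> c"
proof -
  let ?G = "ground X \<union> \<Union>E"
  define v0 p0 where "v0 = vc x" and "p0 = pc x"
  have v0: "v0 \<in> V" and p0: "p0 \<in> P" and kx: "k (v0, p0) = x"
    using coords[OF x] by (auto simp: v0_def p0_def)
  have "closed ?G" by (rule closed_edge_union) (use E closed_ground ends_ground in auto)
  define N where "N = ?G \<inter> cball x (\<epsilon>/2)"
  have GX: "?G \<subseteq> X" using ground_in_X E edgesD(3) by blast
  have "compact ?G" using \<open>closed ?G\<close> GX compact_X by (metis closed_Int_compact inf.absorb1)
  then have N: "compact N" unfolding N_def by (simp add: compact_Int_closed)
  have "(v0, p0) \<in> V \<times> P" using v0 p0 by simp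
  then obtain \<eta>0 where \<eta>0: "0 < \<eta>0" "\<And>z. \<lbrakk>z \<in> V \<times> P; dist z (v0, p0) < \<eta>0\<rbrakk> \<Longrightarrow> dist (k z) x < \<epsilon>/4"
    using cont_k \<epsilon> kx unfolding continuous_on_iff by (metis divide_pos_pos zero_less_numeral)
  define \<eta> where "\<eta> = \<eta>0 / 2"
  have \<eta>: "0 < \<eta>" using \<eta>0(1) by (simp add: \<eta>_def)
  have k_near: "dist (k (v, p)) x < \<epsilon>/4" if "v \<in> V" "p \<in> P" "dist v v0 < \<eta>" "dist p p0 < \<eta>" for v p
  proof (rule \<eta>0(2))
    have "dist (v, p) (v0, p0) \<le> dist v v0 + dist p p0"
      by (simp add: dist_Pair_Pair sqrt_sum_squares_le_sum)
    then show "dist (v, p) (v0, p0) < \<eta>0" using that by (simp add: \<eta>_def)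
  qed (use that in simp)
  obtain B where B: "openin (top_of_set P) B" "connected B" "p0 \<in> B" "B \<subseteq> ball p0 \<eta>"
    using locally_connected_ball[OF lc_P p0 \<eta>] .
  have BP: "B \<subseteq> P" using B(1) openin_imp_subset by blast
  obtain \<beta>0 where \<beta>0: "0 < \<beta>0" "\<And>p. \<lbrakk>p \<in> P; dist p p0 < \<beta>0\<rbrakk> \<Longrightarrow> p \<in> B"
    using openin_dist[OF B(1,3)] by metis
  have "openin (top_of_set V) (V \<inter> ball v0 \<eta>)" "v0 \<in> V \<inter> ball v0 \<eta>"
    using v0 \<eta> by (auto simp: openin_open_Int)
  then obtain W where W: "openin (top_of_set V) W" "closedin (top_of_set V) W" "v0 \<in> W" "W \<subseteq> V \<inter> ball v0 \<eta>"
    using zero_dim_V v0 unfolding zero_dimensional_def by blast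
  obtain \<omega> where \<omega>: "0 < \<omega>" "\<And>v. \<lbrakk>v \<in> V; dist v v0 < \<omega>\<rbrakk> \<Longrightarrow> v \<in> W"
    using openin_dist[OF W(1,3)] by metis
  \<comment> \<open>The bound \<open>\<beta>0\<close> puts the ends of the edge on slices. With
    \<open>\<epsilon>/4\<close>, an edge with an end within \<open>\<epsilon>/4\<close> of
    \<open>x\<close> stays in \<open>cball x (\<epsilon>/2)\<close>.\<close>
  define \<beta> where "\<beta> = min \<beta>0 (\<epsilon>/4)"
  have \<beta>: "0 < \<beta>" "\<beta> \<le> \<beta>0" "\<beta> \<le> \<epsilon>/4" using \<beta>0(1) \<epsilon> by (auto simp: \<beta>_def)
  obtain \<delta>1 where \<delta>1: "0 < \<delta>1" and cut:
    "\<And>VA VB w. \<lbrakk>compact VA; compact VB; VA \<union> VB = W; VA \<inter> VB = {}; v0 \<in> VA; w \<in> VB; dist v0 w < \<delta>1\<rbrakk>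
      \<Longrightarrow> \<exists>e\<in>colour i. small_edge \<beta> e \<and> (\<exists>a b. {a, b} = {\<gamma> e 0, \<gamma> e 1} \<and>
        vc a \<in> VA \<and> vc b \<in> VB \<and> dist (pc a) p0 < \<beta> \<and> dist (pc b) p0 < \<beta>)"
    by (rule cut_edge[OF v0 p0 \<beta>(1) W(1-3), of i]) (rule that)
  define \<mu> where "\<mu> = min \<delta>1 (min \<beta>0 \<omega>)"
  have \<mu>: "0 < \<mu>" "\<mu> \<le> \<delta>1" "\<mu> \<le> \<beta>0" "\<mu> \<le> \<omega>" using \<delta>1 \<beta>0(1) \<omega>(1) by (auto simp: \<mu>_def)
  obtain \<delta> where \<delta>: "0 < \<delta>" "\<And>y. \<lbrakk>y \<in> ground X; dist y x < \<delta>\<rbrakk> \<Longrightarrow> dist (h y) (h x) < \<mu>"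
    using cont_h x \<mu>(1) unfolding continuous_on_iff by metis
  show thesis
  proof (rule that[OF \<delta>(1)])
    fix y assume y: "y \<in> ground X" "dist y x < \<delta>"
    define w q where "w = vc y" and "q = pc y"
    have w: "w \<in> V" "q \<in> P" "k (w, q) = y" using coords[OF y(1)] by (auto simp: w_def q_def)
    have "dist w v0 < \<mu>" "dist q p0 < \<mu>"
      using \<delta>(2)[OF y] dist_fst_le[of "h y" "h x"] dist_snd_le[of "h y" "h x"]
      by (auto simp: w_def q_def v0_def p0_def vc_def pc_def)
    then have wW: "w \<in> W" and qB: "q \<in> B" and wd: "dist v0 w < \<delta>1"
      using \<mu> \<omega>(2)[OF w(1)] \<beta>0(2)[OF w(2)] by (auto simp: dist_commute)
    define L where "L u = k ` ({u} \<times> B)" for u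
    have WV: "W \<subseteq> V" using W(4) by blast
    have L: "connected (L u)" "L u \<subseteq> N" "k (u, p0) \<in> L u" if u: "u \<in> W" for u
    proof -
      have "connected ({u} \<times> B)" using B(2) by (intro connected_Times) auto
      then show "connected (L u)"
        unfolding L_def using cont_k u WV BP
        by (intro connected_continuous_image) (auto intro: continuous_on_subset)
      show "L u \<subseteq> N"
      proof
        fix z assume "z \<in> L u"
        then obtain p where p: "p \<in> B" "z = k (u, p)" by (auto simp: L_def)
        have "dist z x < \<epsilon>/4"
          unfolding p(2) by (rule k_near) (use u W(4) p B(4) BP in \<open>auto simp: dist_commute\<close>)
        moreover have "z \<in> ground X" using k_ground[of u p] u WV p BP by auto
        ultimately show "z \<in> N" using \<epsilon> by (auto simp: N_def dist_commute)
      qed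
      show "k (u, p0) \<in> L u" using B(3) by (auto simp: L_def)
    qed
    have xN: "x \<in> N" using x \<epsilon> by (simp add: N_def)
    have yN: "y \<in> N" using L(2)[OF wW] w(3) qB by (auto simp: L_def)
    have "\<exists>c. connected c \<and> c \<subseteq> N \<and> x \<in> c \<and> y \<in> c"
    proof (rule ccontr)
      assume "\<nexists>c. connected c \<and> c \<subseteq> N \<and> x \<in> c \<and> y \<in> c"
      then obtain A A' where A: "compact A" "compact A'" "A \<union> A' = N" "A \<inter> A' = {}" "x \<in> A" "y \<in> A'"
        using compact_separation[OF N xN yN] by metis
      have clA: "closed A" "closed A'" using A by (auto intro: compact_imp_closed)
      have one: "C \<subseteq> A \<or> C \<subseteq> A'" if "connected C" "C \<subseteq> N" for C
      proof -
        have "A \<inter> A' \<inter> C = {}" "C \<subseteq> A \<union> A'" using that(2) A(3,4) by auto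
        from connected_closedD[OF that(1) this clA] show ?thesis using that(2) A(3) by blast
      qed
      \<comment> \<open>The side of a slice is tested at its point over \<open>p0\<close>;
        continuity in \<open>u\<close> makes both parts compact.\<close>
      define VA where "VA = {u \<in> W. k (u, p0) \<in> A}"
      define VB where "VB = {u \<in> W. k (u, p0) \<in> A'}"
      have cW: "compact W" using W(2) compact_V closedin_compact by blast
      have contu: "continuous_on W (\<lambda>u. k (u, p0))"
        by (rule continuous_on_compose2[OF cont_k]) (use WV p0 in \<open>auto intro!: continuous_intros\<close>)
      have pre: "compact {u \<in> W. k (u, p0) \<in> C}" if "closed C" for C
      proof -
        have "{u \<in> W. k (u, p0) \<in> C} = W \<inter> (\<lambda>u. k (u, p0)) -` C" by auto
        then have "closed {u \<in> W. k (u, p0) \<in> C}"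
          using continuous_closed_preimage[OF contu compact_imp_closed[OF cW] that] by simp
        then have "compact (W \<inter> {u \<in> W. k (u, p0) \<in> C})" using cW by (rule compact_Int_closed[rotated])
        moreover have "W \<inter> {u \<in> W. k (u, p0) \<in> C} = {u \<in> W. k (u, p0) \<in> C}" by auto
        ultimately show ?thesis by simp
      qed
      have LA: "L u \<subseteq> A" if "u \<in> VA" for u
        using one[OF L(1,2), of u] L(3)[of u] that A(4) by (auto simp: VA_def)
      have LB: "L u \<subseteq> A'" if "u \<in> VB" for u
        using one[OF L(1,2), of u] L(3)[of u] that A(4) by (auto simp: VB_def)
      have un: "VA \<union> VB = W" using L(2,3) A(3) by (auto simp: VA_def VB_def)
      have "w \<in> VB"
      proof (rule ccontr)
        assume "w \<notin> VB"
        then have "L w \<subseteq> A" using un wW LA by blast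
        moreover have "y \<in> L w" using w(3) qB by (auto simp: L_def)
        ultimately show False using A(4,6) by blast
      qed
      moreover have "v0 \<in> VA" using W(3) kx A(5) by (simp add: VA_def)
      moreover have "VA \<inter> VB = {}" using A(4) by (auto simp: VA_def VB_def)
      ultimately obtain e a b where e: "e \<in> colour i" "small_edge \<beta> e" "{a, b} = {\<gamma> e 0, \<gamma> e 1}"
        "vc a \<in> VA" "vc b \<in> VB" "dist (pc a) p0 < \<beta>" "dist (pc b) p0 < \<beta>"
        using cut[OF pre[OF clA(1), folded VA_def] pre[OF clA(2), folded VB_def] un _ _ _ wd] by blast
      have eE: "e \<in> E" "e \<in> edges X" using e(1) E by auto
      have ab: "a \<in> closure e" "b \<in> closure e" "a \<in> ground X" "b \<in> ground X"
        using e(3) edge_closure(2)[OF eE(2)] ends_ground[OF eE(2)] by (auto simp: doubleton_eq_iff)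
      have pB: "pc a \<in> B" "pc b \<in> B" using e(6,7) \<beta>(2) coords(2)[OF ab(3)] coords(2)[OF ab(4)] \<beta>0(2) by auto
      have "a = k (vc a, pc a)" "b = k (vc b, pc b)" using coords(3)[OF ab(3)] coords(3)[OF ab(4)] by auto
      then have "a \<in> L (vc a)" "b \<in> L (vc b)" using pB by (auto simp: L_def)
      then have aA: "a \<in> A" and bA: "b \<in> A'" using LA[OF e(4)] LB[OF e(5)] by auto
      have vaW: "vc a \<in> W" using e(4) by (simp add: VA_def)
      have "dist a x < \<epsilon>/4"
      proof -
        have "dist (k (vc a, pc a)) x < \<epsilon>/4"
          by (rule k_near) (use coords[OF ab(3)] vaW W(4) pB B(4) in \<open>auto simp: dist_commute\<close>)
        then show ?thesis using coords(3)[OF ab(3)] by simp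
      qed
      then have "closure e \<subseteq> cball x (\<epsilon>/2)"
      proof -
        assume ax: "dist a x < \<epsilon>/4"
        have "dist x z \<le> \<epsilon>/2" if "z \<in> closure e" for z
        proof -
          have "dist a z < \<beta>" using e(2) ab(1) that by (simp add: small_edge_def)
          then show ?thesis using ax \<beta>(3) dist_triangle3[of x z a] by linarith
        qed
        then show ?thesis by auto
      qed
      moreover have "closure e \<subseteq> ?G"
        using edge_closure(2)[OF eE(2)] ends_ground[OF eE(2)] eE(1) by auto
      ultimately have "closure e \<subseteq> A \<or> closure e \<subseteq> A'"
        using one edge_closure(4)[OF eE(2)] by (simp add: N_def)
      then show False using ab aA bA A(4) by blast
    qed
    moreover have "N \<subseteq> ?G \<inter> ball x \<epsilon>" using \<epsilon> by (auto simp: N_def)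
    ultimately show "\<exists>c. connected c \<and> c \<subseteq> ?G \<inter> ball x \<epsilon> \<and> x \<in> c \<and> y \<in> c" by blast
  qed
qed

text \<open>Meant for the finitely many large edges, which need not fit into a small neighbourhood
  of \<open>x\<close>. If \<open>x\<close> is off the closed edge, \<open>\<delta>\<close> is so
  small that no \<open>y\<close> qualifies.\<close>

lemma edge_connects_end:
  assumes e: "e \<in> edges X" and \<epsilon>: "0 < \<epsilon>"
  shows "\<exists>\<delta>>0. \<forall>y\<in>closure e. dist y x < \<delta> \<longrightarrow> (\<exists>c. connected c \<and> c \<subseteq> closure e \<inter> ball x \<epsilon> \<and> x \<in> c \<and> y \<in> c)"
proof (cases "x \<in> closure e")
  case True
  obtain C where C: "openin (top_of_set (closure e)) C" "connected C" "x \<in> C" "C \<subseteq> ball x \<epsilon>"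
    using locally_connected_ball[OF edge_closure(6)[OF e] True \<epsilon>] .
  then obtain \<delta> where "0 < \<delta>" "\<And>y. \<lbrakk>y \<in> closure e; dist y x < \<delta>\<rbrakk> \<Longrightarrow> y \<in> C"
    using openin_dist[OF C(1,3)] by metis
  moreover have "C \<subseteq> closure e" using C(1) openin_imp_subset by blast
  ultimately show ?thesis using C by blast
next
  case False
  then obtain \<delta> where "0 < \<delta>" "ball x \<delta> \<subseteq> - closure e"
    by (meson ComplI closed_closure open_Compl open_contains_ball)
  then have "\<not> dist y x < \<delta>" if "y \<in> closure e" for y using that by (auto simp: dist_commute subset_iff)
  then show ?thesis using \<open>0 < \<delta>\<close> by blast
qed

text \<open>Connectedness im kleinen at each point is enough. Near a ground point, a point of a
  small edge is reached through the end \<open>\<gamma> e 0\<close>, itself near \<open>x\<close>,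
  followed by the closed edge. The remaining edges are finitely many, so the minimum of their
  individual radii is positive.\<close>

lemma colour_locally_connected:
  assumes E: "colour i \<subseteq> E" "E \<subseteq> edges X"
  shows "locally connected (ground X \<union> \<Union>E)"
  unfolding locally_connected_im_kleinen
proof (intro allI impI, elim conjE)
  let ?G = "ground X \<union> \<Union>E"
  have GX: "?G \<subseteq> X" using ground_in_X E edgesD(3) by blast
  fix v x assume v: "openin (top_of_set ?G) v" "x \<in> v"
  have xG: "x \<in> ?G" using v openin_imp_subset by blast
  show "\<exists>u. openin (top_of_set ?G) u \<and> x \<in> u \<and> u \<subseteq> v \<and>
    (\<forall>y. y \<in> u \<longrightarrow> (\<exists>c. connected c \<and> c \<subseteq> v \<and> x \<in> c \<and> y \<in> c))"
  proof (cases "x \<in> ground X")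
    case False
    then obtain e where e: "e \<in> E" "x \<in> e" using xG by blast
    obtain T where T: "open T" "v = ?G \<inter> T" using v(1) by (auto simp: openin_open)
    have "openin (top_of_set X) (e \<inter> T)" using edgesD(2)[of e] e E T(1) by (auto simp: openin_Int_open)
    then obtain u where u: "openin (top_of_set X) u" "connected u" "x \<in> u" "u \<subseteq> e \<inter> T"
      using lc_X e(2) v(2) T(2) unfolding locally_connected by blast
    have "u \<subseteq> v" using u(4) T(2) e(1) by blast
    moreover have "u \<subseteq> ?G" using u(4) e(1) by blast
    from openin_subset_trans[OF u(1) this GX] have "openin (top_of_set ?G) u" .
    ultimately show ?thesis using u(2,3) by metis
  next
    case True
    obtain \<epsilon> where \<epsilon>: "0 < \<epsilon>" "\<And>y. \<lbrakk>y \<in> ?G; dist y x < \<epsilon>\<rbrakk> \<Longrightarrow> y \<in> v"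
      using openin_dist[OF v] by metis
    have inv: "c \<subseteq> v" if "c \<subseteq> ?G \<inter> ball x \<epsilon>" for c
      using that \<epsilon>(2) by (auto simp: dist_commute subset_iff)
    obtain \<delta>1 where \<delta>1: "0 < \<delta>1" "\<And>y. \<lbrakk>y \<in> ground X; dist y x < \<delta>1\<rbrakk> \<Longrightarrow>
      \<exists>c. connected c \<and> c \<subseteq> ?G \<inter> ball x \<epsilon> \<and> x \<in> c \<and> y \<in> c"
      by (rule colour_connects_ground[OF E True \<epsilon>(1)], rule that)
    define \<delta>' where "\<delta>' = min \<delta>1 \<epsilon>"
    have \<delta>': "0 < \<delta>'" "\<delta>' \<le> \<delta>1" "\<delta>' \<le> \<epsilon>" using \<delta>1(1) \<epsilon>(1) by (auto simp: \<delta>'_def)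
    let ?F = "{e \<in> edges X. \<not> small_edge (\<delta>'/2) e}"
    have fin: "finite ?F" using finite_large_edges[of "\<delta>'/2"] \<delta>'(1) by simp
    have "\<forall>e\<in>?F. \<exists>\<delta>>0. \<forall>y\<in>closure e. dist y x < \<delta> \<longrightarrow>
        (\<exists>c. connected c \<and> c \<subseteq> closure e \<inter> ball x \<epsilon> \<and> x \<in> c \<and> y \<in> c)"
      using edge_connects_end[OF _ \<epsilon>(1)] by blast
    from bchoice[OF this] obtain d where "\<forall>e\<in>?F. 0 < d e \<and> (\<forall>y\<in>closure e. dist y x < d e \<longrightarrow>
        (\<exists>c. connected c \<and> c \<subseteq> closure e \<inter> ball x \<epsilon> \<and> x \<in> c \<and> y \<in> c))" ..
    then have d: "0 < d e" "\<lbrakk>y \<in> closure e; dist y x < d e\<rbrakk> \<Longrightarrow>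
        \<exists>c. connected c \<and> c \<subseteq> closure e \<inter> ball x \<epsilon> \<and> x \<in> c \<and> y \<in> c" if "e \<in> ?F" for e y
      using that by (auto simp del: Int_iff mem_Collect_eq)
    define \<delta> where "\<delta> = Min (insert (\<delta>'/2) (d ` ?F))"
    have \<delta>: "0 < \<delta>" unfolding \<delta>_def by (subst Min_gr_iff) (use fin d(1) \<delta>'(1) in auto)
    have \<delta>le: "\<delta> \<le> \<delta>'/2" "\<And>e. e \<in> ?F \<Longrightarrow> \<delta> \<le> d e"
      unfolding \<delta>_def by (rule Min_le; use fin in auto)+
    have clG: "closure e \<subseteq> ?G" if "e \<in> E" for e
      using edge_closure(2)[of e] ends_ground[of e] that E by auto
    have main: "\<exists>c. connected c \<and> c \<subseteq> v \<and> x \<in> c \<and> y \<in> c" if y: "y \<in> ?G" "dist y x < \<delta>" for y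
    proof (cases "y \<in> ground X")
      case True
      then show ?thesis using \<delta>1(2)[of y] y \<delta>le(1) \<delta>' inv by (metis (no_types, lifting) field_sum_of_halves less_add_same_cancel1 half_gt_zero order_less_le_trans order_less_trans)
    next
      case False
      then obtain e where e: "e \<in> E" "y \<in> e" using y by blast
      have eX: "e \<in> edges X" using e E by blast
      have ye: "y \<in> closure e" using e(2) closure_subset by blast
      show ?thesis
      proof (cases "small_edge (\<delta>'/2) e")
        case False
        then have eF: "e \<in> ?F" using eX by blast
        then have "dist y x < d e" using y(2) \<delta>le(2)[OF eF] by linarith
        then obtain c where "connected c" "c \<subseteq> closure e \<inter> ball x \<epsilon>" "x \<in> c" "y \<in> c"
          using d(2)[OF eF ye] by blast
        then show ?thesis using inv[of c] clG[OF e(1)] by blast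
      next
        case True
        let ?a = "\<gamma> e 0"
        have ae: "?a \<in> closure e" using edge_closure(2)[OF eX] by auto
        have near: "dist z x < \<delta>'" if "z \<in> closure e" for z
        proof -
          have "dist z y < \<delta>'/2" using True that ye by (simp add: small_edge_def)
          then show ?thesis using y(2) \<delta>le(1) dist_triangle[of z x y] by linarith
        qed
        have "dist ?a x < \<delta>1" using near[OF ae] \<delta>' by linarith
        then obtain c where c: "connected c" "c \<subseteq> ?G \<inter> ball x \<epsilon>" "x \<in> c" "?a \<in> c"
          using \<delta>1(2)[OF ends_ground(1)[OF eX]] by blast
        have "connected (c \<union> closure e)"
          using c(1,4) edge_closure(4)[OF eX] ae by (intro connected_Un) auto
        moreover have "closure e \<subseteq> ball x \<epsilon>" using near \<delta>'(3) by (force simp: dist_commute)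
        then have "c \<union> closure e \<subseteq> v" using c(2) clG[OF e(1)] by (intro inv) auto
        ultimately show ?thesis using c(3) ye by blast
      qed
    qed
    show ?thesis
    proof (intro exI conjI)
      show "openin (top_of_set ?G) (?G \<inter> ball x \<delta>)" by (simp add: openin_open_Int)
      show "x \<in> ?G \<inter> ball x \<delta>" using xG \<delta> by simp
      have "\<delta> \<le> \<epsilon>" using \<delta>le(1) \<delta>' \<epsilon>(1) by linarith
      then show "?G \<inter> ball x \<delta> \<subseteq> v" by (intro inv) auto
      show "\<forall>y. y \<in> ?G \<inter> ball x \<delta> \<longrightarrow> (\<exists>c. connected c \<and> c \<subseteq> v \<and> x \<in> c \<and> y \<in> c)"
        using main by (simp add: dist_commute)
    qed
  qed
qed

end

section \<open>Density\<close>

text \<open>An injective sequence places \<open>f (2 * n)\<close> and \<open>f (2 * n + 1)\<close>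
  in the n-th set; \<open>U\<close> collects the values at even indices.\<close>

lemma split_infinite_sets:
  fixes \<A> :: "'a set set"
  assumes "countable \<A>" and inf: "\<And>A. A \<in> \<A> \<Longrightarrow> infinite A"
  shows "\<exists>U. \<forall>A\<in>\<A>. A \<inter> U \<noteq> {} \<and> A - U \<noteq> {}"
proof (cases "\<A> = {}")
  case False
  define A where "A n = from_nat_into \<A> n" for n
  have A: "infinite (A n)" for n using inf from_nat_into[OF False] by (simp add: A_def)
  have "\<exists>f. \<forall>n. f n \<in> A (n div 2) \<and> f n \<notin> f ` {..<n}"
  proof (rule dependent_wellorder_choice)
    fix n :: nat and f :: "nat \<Rightarrow> 'a"
    have "\<not> A (n div 2) \<subseteq> f ` {..<n}" using A finite_subset by (metis finite_imageI finite_lessThan)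
    then show "\<exists>x. x \<in> A (n div 2) \<and> x \<notin> f ` {..<n}" by blast
  next
    fix x and f g :: "nat \<Rightarrow> 'a" and n assume "\<And>m. m < n \<Longrightarrow> f m = g m"
    then have "f ` {..<n} = g ` {..<n}" by auto
    then show "(x \<in> A (n div 2) \<and> x \<notin> f ` {..<n}) = (x \<in> A (n div 2) \<and> x \<notin> g ` {..<n})" by simp
  qed
  then obtain f where f: "\<And>n. f n \<in> A (n div 2)" "\<And>n. f n \<notin> f ` {..<n}" by blast
  have ne: "f m \<noteq> f n" if "m \<noteq> n" for m n
    using f(2)[of m] f(2)[of n] that
    by (metis imageI lessThan_iff linorder_neqE_nat)
  define U where "U = range (\<lambda>n. f (2 * n))"
  have AU: "A n \<inter> U \<noteq> {}" "A n - U \<noteq> {}" for n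
  proof -
    have "f (2 * n) \<in> A n" using f(1)[of "2 * n"] by simp
    then show "A n \<inter> U \<noteq> {}" by (auto simp: U_def)
    have "2 * n + 1 \<noteq> 2 * m" for m by presburger
    then have "f (2 * n + 1) \<notin> U" using ne by (auto simp: U_def simp del: One_nat_def)
    then show "A n - U \<noteq> {}" using f(1)[of "2 * n + 1"] by auto
  qed
  have "\<exists>n. A n = B" if "B \<in> \<A>" for B
    using from_nat_into_surj[OF assms(1) that] by (simp add: A_def)
  then show ?thesis using AU by metis
qed simp

text \<open>Total boundedness provides countably many balls such that every
  \<open>ball x \<epsilon>\<close> contains one of them with \<open>x\<close> inside. It suffices to
  split the families of members lying in such a ball, whenever infinite.\<close>

lemma split_dense_family:
  fixes X :: "'a::metric_space set"
  assumes "compact X" and ne: "\<And>e. e \<in> E \<Longrightarrow> e \<noteq> {}"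
  obtains U where "\<And>x. \<lbrakk>x \<in> X; \<And>\<epsilon>. 0 < \<epsilon> \<Longrightarrow> infinite {e \<in> E. e \<subseteq> ball x \<epsilon>}\<rbrakk>
    \<Longrightarrow> x \<in> closure (\<Union>(E \<inter> U)) \<and> x \<in> closure (\<Union>(E - U))"
proof -
  have "\<exists>k. finite k \<and> k \<subseteq> X \<and> X \<subseteq> (\<Union>x\<in>k. ball x (1 / (real n + 1)))" for n
    using seq_compact_imp_totally_bounded[of X] assms(1) compact_imp_seq_compact by (metis of_nat_0_le_iff add_nonneg_pos zero_less_divide_1_iff zero_less_one)
  then obtain K where K: "\<And>n. finite (K n)" "\<And>n. X \<subseteq> (\<Union>x\<in>K n. ball x (1 / (real n + 1)))" by metis
  define \<B> where "\<B> = (\<Union>n. (\<lambda>x. ball x (1 / (real n + 1))) ` K n)"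
  have "countable \<B>"
    unfolding \<B>_def using K(1) by (intro countable_UN[OF countableI_type] countable_finite finite_imageI) auto
  define \<A> where "\<A> = {A \<in> (\<lambda>B. {e \<in> E. e \<subseteq> B}) ` \<B>. infinite A}"
  have "countable \<A>"
    unfolding \<A>_def using countable_image[OF \<open>countable \<B>\<close>] by (rule countable_subset[rotated]) blast
  then obtain U where U: "\<And>A. A \<in> \<A> \<Longrightarrow> A \<inter> U \<noteq> {} \<and> A - U \<noteq> {}"
    using split_infinite_sets[of \<A>] unfolding \<A>_def by (metis (no_types, lifting) mem_Collect_eq)
  show thesis
  proof (rule that[of U])
    fix x assume x: "x \<in> X" and inf: "\<And>\<epsilon>. 0 < \<epsilon> \<Longrightarrow> infinite {e \<in> E. e \<subseteq> ball x \<epsilon>}"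
    have *: "\<exists>e e'. e \<in> E \<inter> U \<and> e' \<in> E - U \<and> e \<subseteq> ball x \<epsilon> \<and> e' \<subseteq> ball x \<epsilon>" if \<epsilon>: "0 < \<epsilon>" for \<epsilon>
    proof -
      obtain n :: nat where n: "2 / \<epsilon> < real n" using reals_Archimedean2 by blast
      have n': "2 * (1 / (real n + 1)) < \<epsilon>"
      proof -
        have "2 / \<epsilon> < real n + 1" using n by simp
        then show ?thesis using \<epsilon> by (simp add: field_simps)
      qed
      obtain c where c: "c \<in> K n" "x \<in> ball c (1 / (real n + 1))" using K(2)[of n] x by blast
      let ?B = "ball c (1 / (real n + 1))"
      have "?B \<subseteq> ball x \<epsilon>"
      proof
        fix z assume z: "z \<in> ?B"
        show "z \<in> ball x \<epsilon>" using z c(2) n' dist_triangle3[of x z c] by simp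
      qed
      obtain s where s: "0 < s" "ball x s \<subseteq> ?B" using c(2) by (meson open_ball open_contains_ball)
      have "{e \<in> E. e \<subseteq> ball x s} \<subseteq> {e \<in> E. e \<subseteq> ?B}" using s(2) by auto
      then have "infinite {e \<in> E. e \<subseteq> ?B}" using inf[OF s(1)] finite_subset by blast
      moreover have "?B \<in> \<B>" using c(1) by (auto simp: \<B>_def)
      ultimately have "{e \<in> E. e \<subseteq> ?B} \<in> \<A>" by (simp add: \<A>_def)
      from U[OF this] show ?thesis using \<open>?B \<subseteq> ball x \<epsilon>\<close> by blast
    qed
    have cl: "x \<in> closure (\<Union>F)" if F: "F \<subseteq> E" "\<And>\<epsilon>. 0 < \<epsilon> \<Longrightarrow> \<exists>e\<in>F. e \<subseteq> ball x \<epsilon>" for F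
      unfolding closure_approachable
    proof (intro allI impI)
      fix \<epsilon> :: real assume "0 < \<epsilon>"
      then obtain e where "e \<in> F" "e \<subseteq> ball x \<epsilon>" using F(2) by blast
      moreover then obtain y where "y \<in> e" using ne F(1) by blast
      ultimately show "\<exists>y\<in>\<Union>F. dist y x < \<epsilon>" by (auto simp: dist_commute subset_iff)
    qed
    show "x \<in> closure (\<Union>(E \<inter> U)) \<and> x \<in> closure (\<Union>(E - U))"
      by (intro conjI cl) (use * in blast)+
  qed
qed

context product_ground
begin

text \<open>Otherwise density would cover the ground space near \<open>x\<close> by the closures of
  finitely many edges, the small ones near \<open>x\<close> and the large ones, hence by finitely
  many ends. But \<open>x\<close> is a limit point of its own copy of \<open>P\<close>.\<close>

lemma infinite_edges_near:
  assumes dense: "X \<subseteq> closure (\<Union>(edges X))" and x: "x \<in> ground X" and \<epsilon>: "0 < \<epsilon>"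
  shows "infinite {e \<in> edges X. closure e \<subseteq> ball x \<epsilon>}"
proof
  assume "finite {e \<in> edges X. closure e \<subseteq> ball x \<epsilon>}"
  moreover have "finite {e \<in> edges X. \<not> small_edge (\<epsilon>/2) e}" using \<epsilon> by (intro finite_large_edges) simp
  ultimately have fin: "finite ({e \<in> edges X. closure e \<subseteq> ball x \<epsilon>} \<union> {e \<in> edges X. \<not> small_edge (\<epsilon>/2) e})"
    (is "finite ?H") by (rule finite_UnI)
  have "\<Union>(edges X) \<subseteq> - ball x (\<epsilon>/2) \<union> (\<Union>e\<in>?H. closure e)"
  proof
    fix y assume "y \<in> \<Union>(edges X)"
    then obtain e where e: "e \<in> edges X" "y \<in> e" by blast
    have ye: "y \<in> closure e" using e(2) closure_subset by blast
    show "y \<in> - ball x (\<epsilon>/2) \<union> (\<Union>e\<in>?H. closure e)"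
    proof (cases "y \<in> ball x (\<epsilon>/2) \<and> small_edge (\<epsilon>/2) e")
      case True
      have "z \<in> ball x \<epsilon>" if "z \<in> closure e" for z
      proof -
        have "dist y z < \<epsilon>/2" using True ye that by (simp add: small_edge_def)
        then show ?thesis using True dist_triangle[of x z y] by simp
      qed
      then have "e \<in> ?H" using e(1) by blast
      then show ?thesis using ye by blast
    next
      case False
      then show ?thesis using e(1) ye by blast
    qed
  qed
  moreover have "closed (- ball x (\<epsilon>/2) \<union> (\<Union>e\<in>?H. closure e))"
    using fin by (intro closed_Un closed_UN closed_Compl) auto
  ultimately have "closure (\<Union>(edges X)) \<subseteq> - ball x (\<epsilon>/2) \<union> (\<Union>e\<in>?H. closure e)" by (rule closure_minimal)
  then have sub: "ground X \<inter> ball x (\<epsilon>/2) \<subseteq> (\<Union>e\<in>?H. closure e)" using dense ground_in_X by blast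
  have "ground X \<inter> ball x (\<epsilon>/2) \<subseteq> (\<lambda>e. \<gamma> e 0) ` ?H \<union> (\<lambda>e. \<gamma> e 1) ` ?H"
  proof
    fix y assume y: "y \<in> ground X \<inter> ball x (\<epsilon>/2)"
    then obtain e where e: "e \<in> ?H" "y \<in> closure e" using sub by blast
    then have "e \<in> edges X" by blast
    then have "y = \<gamma> e 0 \<or> y = \<gamma> e 1"
      using e(2) edge_closure(2)[of e] edge_not_ground[of e y] y by blast
    then show "y \<in> (\<lambda>e. \<gamma> e 0) ` ?H \<union> (\<lambda>e. \<gamma> e 1) ` ?H" using e(1) by blast
  qed
  then have "finite (ground X \<inter> ball x (\<epsilon>/2))"
    by (rule finite_subset) (rule finite_UnI[OF finite_imageI[OF fin] finite_imageI[OF fin]])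
  moreover have "x islimpt ground X"
  proof -
    let ?L = "k ` ({vc x} \<times> P)"
    note cx = coords[OF x]
    have "connected ({vc x} \<times> P)" using connected_P by (intro connected_Times) auto
    then have "connected ?L"
      using cont_k cx(1) by (intro connected_continuous_image) (auto intro: continuous_on_subset)
    moreover have "x \<in> ?L" using cx by force
    moreover have "?L \<noteq> {z}" for z
    proof
      assume L: "?L = {z}"
      obtain p q where pq: "p \<in> P" "q \<in> P" "p \<noteq> q" using nondeg by blast
      then have "k (vc x, p) \<in> {z}" "k (vc x, q) \<in> {z}" unfolding L[symmetric] by blast+
      then have "k (vc x, p) = k (vc x, q)" by simp
      then show False using pc_k[OF cx(1) pq(1)] pc_k[OF cx(1) pq(2)] pq(3) by simp
    qed
    ultimately have "x islimpt ?L" by (intro connected_imp_perfect)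
    moreover have "?L \<subseteq> ground X" using k_ground cx(1) by auto
    ultimately show ?thesis by (rule islimpt_subset)
  qed
  ultimately show False using \<epsilon> unfolding islimpt_eq_infinite_ball by (meson half_gt_zero)
qed

end

context coloured
begin

text \<open>Over an isolated point of \<open>V\<close> the edges near the ground space are loops of that copy of
  \<open>P\<close>, which must be split separately; elsewhere local connectedness forces edges to be present.\<close>

lemma colour_dense:
  assumes dense: "X \<subseteq> closure (\<Union>(edges X))" and E: "colour i \<subseteq> E" "E \<subseteq> edges X" and x: "x \<in> ground X"
    and loops: "(\<And>\<epsilon>. 0 < \<epsilon> \<Longrightarrow> infinite {e \<in> edges X. gap e = 0 \<and> e \<subseteq> ball x \<epsilon>}) \<Longrightarrow> x \<in> closure (\<Union>E)"
  shows "x \<in> closure (\<Union>E)"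
proof (rule ccontr)
  assume notin: "x \<notin> closure (\<Union>E)"
  then obtain \<epsilon>0 where "0 < \<epsilon>0" "\<not> infinite {e \<in> edges X. gap e = 0 \<and> e \<subseteq> ball x \<epsilon>0}" using loops by blast
  note \<epsilon>0 = this
  obtain \<epsilon>1 where "0 < \<epsilon>1" "ball x \<epsilon>1 \<inter> closure (\<Union>E) = {}"
    using notin by (metis closed_closure closed_def ComplI open_contains_ball disjoint_eq_subset_Compl)
  then have \<epsilon>1: "0 < \<epsilon>1" "ball x \<epsilon>1 \<inter> \<Union>E = {}" using closure_subset[of "\<Union>E"] by blast+
  let ?G = "ground X \<union> \<Union>E"
  note cx = coords[OF x]
  obtain C where C: "openin (top_of_set ?G) C" "connected C" "x \<in> C" "C \<subseteq> ball x \<epsilon>1"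
    using locally_connected_ball[OF colour_locally_connected[OF E] _ \<epsilon>1(1)] x by blast
  \<comment> \<open>The ball misses all edges of \<open>E\<close>, so this connected neighbourhood
    lies in the ground space. Its projection to the zero-dimensional \<open>V\<close> is one point,
    which makes \<open>vc x\<close> isolated in \<open>V\<close>.\<close>
  have Cg: "C \<subseteq> ground X" using openin_imp_subset[OF C(1)] C(4) \<epsilon>1(2) by blast
  obtain \<delta> where \<delta>: "0 < \<delta>" "\<And>y. \<lbrakk>y \<in> ?G; dist y x < \<delta>\<rbrakk> \<Longrightarrow> y \<in> C" using openin_dist[OF C(1,3)] by metis
  have "(vc x, pc x) \<in> V \<times> P" using cx by simp
  then obtain \<eta> where \<eta>: "0 < \<eta>" "\<And>z. \<lbrakk>z \<in> V \<times> P; dist z (vc x, pc x) < \<eta>\<rbrakk> \<Longrightarrow> dist (k z) x < \<delta>"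
    using cont_k \<delta>(1) cx(3) unfolding continuous_on_iff by metis
  have isol: "w = vc x" if w: "w \<in> V" "dist w (vc x) < \<eta>" for w
  proof (rule ccontr)
    assume ne: "w \<noteq> vc x"
    have "dist (k (w, pc x)) x < \<delta>" by (rule \<eta>(2)) (use w cx in \<open>auto simp: dist_Pair_Pair\<close>)
    then have wC: "k (w, pc x) \<in> C" using \<delta>(2) k_ground[OF w(1) cx(2)] by blast
    have "openin (top_of_set V) (V \<inter> ball (vc x) (dist (vc x) w))" "vc x \<in> V \<inter> ball (vc x) (dist (vc x) w)"
      using ne cx(1) by (auto simp: openin_open_Int)
    then obtain W where W: "openin (top_of_set V) W" "closedin (top_of_set V) W" "vc x \<in> W"
      "W \<subseteq> V \<inter> ball (vc x) (dist (vc x) w)"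
      using zero_dim_V cx(1) unfolding zero_dimensional_def by blast
    have "continuous_on C vc" unfolding vc_def
      using cont_h Cg by (auto intro!: continuous_intros intro: continuous_on_subset)
    then have con: "connected (vc ` C)" using C(2) by (rule connected_continuous_image)
    have sV: "vc ` C \<subseteq> V" using Cg coords(1) by blast
    have "openin (top_of_set (vc ` C)) (vc ` C \<inter> W)"
    proof -
      obtain T where "open T" "W = V \<inter> T" using W(1) by (auto simp: openin_open)
      moreover then have "vc ` C \<inter> W = vc ` C \<inter> T" using sV by blast
      ultimately show ?thesis by (simp add: openin_open_Int)
    qed
    moreover have "closedin (top_of_set (vc ` C)) (vc ` C \<inter> W)"
    proof -
      obtain T where "closed T" "W = V \<inter> T" using W(2) by (auto simp: closedin_closed)
      moreover then have "vc ` C \<inter> W = vc ` C \<inter> T" using sV by blast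
      ultimately show ?thesis by (simp add: closedin_closed_Int)
    qed
    ultimately have "vc ` C \<inter> W = {} \<or> vc ` C \<inter> W = vc ` C" using con connected_clopen by blast
    then have "vc ` C \<subseteq> W" using C(3) W(3) by blast
    moreover have "w \<in> vc ` C" using wC vc_k[OF w(1) cx(2)] by force
    ultimately have "w \<in> ball (vc x) (dist (vc x) w)" using W(4) by blast
    then show False by simp
  qed
  obtain \<epsilon>2 where \<epsilon>2: "0 < \<epsilon>2" "\<And>y. \<lbrakk>y \<in> ground X; dist y x < \<epsilon>2\<rbrakk> \<Longrightarrow> dist (h y) (h x) < \<eta>"
    using cont_h x \<eta>(1) unfolding continuous_on_iff by metis
  define s where "s = min \<epsilon>0 \<epsilon>2"
  have s: "0 < s" "s \<le> \<epsilon>0" "s \<le> \<epsilon>2" using \<epsilon>0(1) \<epsilon>2(1) by (auto simp: s_def)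
  have vcs: "vc y = vc x" if "y \<in> ground X" "y \<in> ball x s" for y
  proof (rule isol)
    show "vc y \<in> V" by (rule coords(1)[OF that(1)])
    have "dist y x < \<epsilon>2" using that(2) s(3) by (simp add: dist_commute)
    then have "dist (h y) (h x) < \<eta>" by (rule \<epsilon>2(2)[OF that(1)])
    then show "dist (vc y) (vc x) < \<eta>" using dist_fst_le[of "h y" "h x"] by (simp add: vc_def)
  qed
  \<comment> \<open>Edges close to \<open>x\<close> have both ends over the isolated point
    \<open>vc x\<close>, hence gap 0.\<close>
  have "{e \<in> edges X. closure e \<subseteq> ball x s} \<subseteq> {e \<in> edges X. gap e = 0 \<and> e \<subseteq> ball x \<epsilon>0}"
  proof
    fix e assume "e \<in> {e \<in> edges X. closure e \<subseteq> ball x s}"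
    then have e: "e \<in> edges X" "closure e \<subseteq> ball x s" by auto
    then have "\<gamma> e 0 \<in> ball x s" "\<gamma> e 1 \<in> ball x s" using edge_closure(2)[OF e(1)] by auto
    then have "gap e = 0" using vcs ends_ground[OF e(1)] by (simp add: gap_def)
    moreover have "ball x s \<subseteq> ball x \<epsilon>0" using s(2) by (rule subset_ball)
    ultimately show "e \<in> {e \<in> edges X. gap e = 0 \<and> e \<subseteq> ball x \<epsilon>0}" using e closure_subset[of e] by blast
  qed
  then show False
    using infinite_edges_near[OF dense x s(1)] \<epsilon>0(2) finite_subset by blast
qed

lemma edge_partition:
  assumes dense: "X \<subseteq> closure (\<Union>(edges X))"
  shows "\<exists>E1 E2. E1 \<union> E2 = edges X \<and> E1 \<inter> E2 = {} \<and>
     ground X \<subseteq> closure (\<Union>E1) \<and> closure (\<Union>E1) = ground X \<union> \<Union>E1 \<and> locally connected (closure (\<Union>E1)) \<and>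
     ground X \<subseteq> closure (\<Union>E2) \<and> closure (\<Union>E2) = ground X \<union> \<Union>E2 \<and> locally connected (closure (\<Union>E2))"
proof -
  define E0 where "E0 = {e \<in> edges X. gap e = 0}"
  obtain U where U: "\<And>x. \<lbrakk>x \<in> X; \<And>\<epsilon>. 0 < \<epsilon> \<Longrightarrow> infinite {e \<in> E0. e \<subseteq> ball x \<epsilon>}\<rbrakk>
    \<Longrightarrow> x \<in> closure (\<Union>(E0 \<inter> U)) \<and> x \<in> closure (\<Union>(E0 - U))"
    by (rule split_dense_family[OF compact_X, of E0]) (use edgesD(5) E0_def in auto)
  define E2 where "E2 = colour False \<union> (E0 \<inter> U)"
  \<comment> \<open>A class containing a full colour stays locally connected when edges are added,
    so all uncoloured edges of positive gap may go to \<open>E1\<close>.\<close>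
  define E1 where "E1 = edges X - E2"
  have col: "colour i \<subseteq> edges X" for i by (auto simp: colour_def)
  have col0: "colour i \<inter> E0 = {}" for i using colour_gap_pos by (force simp: E0_def)
  have sub: "colour True \<subseteq> E1" "colour False \<subseteq> E2" "E1 \<subseteq> edges X" "E2 \<subseteq> edges X" "E0 \<inter> U \<subseteq> E2" "E0 - U \<subseteq> E1"
    using col[of True] col[of False] col0[of True] col0[of False] colour_disjoint
    by (auto simp: E1_def E2_def E0_def)
  have main: "ground X \<subseteq> closure (\<Union>E) \<and> closure (\<Union>E) = ground X \<union> \<Union>E \<and> locally connected (closure (\<Union>E))"
    if E: "colour i \<subseteq> E" "E \<subseteq> edges X" "E0 \<inter> U \<subseteq> E \<or> E0 - U \<subseteq> E" for i E
  proof -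
    have "x \<in> closure (\<Union>E)" if x: "x \<in> ground X" for x
    proof (rule colour_dense[OF dense E(1,2) x])
      assume "\<And>\<epsilon>. 0 < \<epsilon> \<Longrightarrow> infinite {e \<in> edges X. gap e = 0 \<and> e \<subseteq> ball x \<epsilon>}"
      then have "x \<in> closure (\<Union>(E0 \<inter> U)) \<and> x \<in> closure (\<Union>(E0 - U))"
        using x ground_in_X by (intro U) (auto simp: E0_def conj_assoc)
      then show "x \<in> closure (\<Union>E)" using E(3) closure_mono Union_mono by (metis subsetD)
    qed
    then have g: "ground X \<subseteq> closure (\<Union>E)" by blast
    have "closed (ground X \<union> \<Union>E)"
      by (rule closed_edge_union) (use E closed_ground ends_ground in auto)
    then have "closure (\<Union>E) \<subseteq> ground X \<union> \<Union>E" by (intro closure_minimal) auto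
    then have "closure (\<Union>E) = ground X \<union> \<Union>E" using g closure_subset by blast
    then show ?thesis using g colour_locally_connected[OF E(1,2)] by simp
  qed
  show ?thesis
    by (rule exI[of _ E1], rule exI[of _ E2])
      (use main[OF sub(1,3)] main[OF sub(2,4)] sub in \<open>auto simp: E1_def\<close>)
qed

end

theorem theorem4:
  fixes X :: "'a::metric_space set" and V :: "'b::metric_space set" and P :: "'c::metric_space set"
  assumes "peano_graph X"
    and "compact V" and "zero_dimensional V"
    and "peano_continuum P" and "\<exists>p\<in>P. \<exists>q\<in>P. p \<noteq> q"
    and "ground X homeomorphic (V \<times> P)"
  shows "\<exists>E1 E2. E1 \<union> E2 = edges X \<and> E1 \<inter> E2 = {} \<and>
     ground X \<subseteq> closure (\<Union>E1) \<and> closure (\<Union>E1) = ground X \<union> \<Union>E1 \<and> locally connected (closure (\<Union>E1)) \<and>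
     ground X \<subseteq> closure (\<Union>E2) \<and> closure (\<Union>E2) = ground X \<union> \<Union>E2 \<and> locally connected (closure (\<Union>E2))"
proof -
  have X: "compact X" "connected X" "locally connected X" and dense: "X \<subseteq> closure (\<Union>(edges X))"
    using assms(1) by (auto simp: peano_graph_def peano_continuum_def)
  have P: "compact P" "connected P" using assms(4) by (auto simp: peano_continuum_def)
  show ?thesis
  proof (cases "ground X = {}")
    \<comment> \<open>Edges may overlap here, so no genuine splitting is attempted:
      \<open>edges X\<close> and \<open>{}\<close> satisfy the conclusion.\<close>
    case True
    moreover have "\<Union>(edges X) \<subseteq> X" using edgesD(3) by blast
    ultimately have "\<Union>(edges X) = X" by (auto simp: ground_def)
    moreover have "closure X = X" using X(1) by (simp add: compact_imp_closed)
    ultimately show ?thesis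
      using True X(3) by (intro exI[of _ "edges X"] exI[of _ "{}"]) (simp add: locally_empty)
  next
    case False
    obtain h k where hk: "homeomorphism (ground X) (V \<times> P) h k" using assms(6) by (auto simp: homeomorphic_def)
    interpret product_ground X V P h k
      by unfold_locales (use X False assms hk in auto)
    obtain D where D: "\<And>n i. finite (D n i)" "\<And>n i. D n i \<subseteq> P"
      "\<And>n i p. p \<in> P \<Longrightarrow> \<exists>c\<in>D n i. dist p c < 1 / (real n + 1)"
      "\<And>m n i. \<lbrakk>m \<le> n + 1; n \<le> m + 1\<rbrakk> \<Longrightarrow> D m i \<inter> D n (\<not> i) = {}"
      by (rule two_coloured_nets[OF P assms(5)], rule that)
    obtain r where r: "\<And>n. 0 < r n" "\<And>n. r n < 1 / (real n + 1)"
      "\<And>m n i c c'. \<lbrakk>m \<le> n + 1; n \<le> m + 1; c \<in> D m True; c' \<in> D n False\<rbrakk> \<Longrightarrow> r m + r n \<le> dist c c'"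
      by (rule separated_radii[of D, OF D(1) D(4)], assumption, assumption, rule that)
    obtain t where t: "\<And>n. 0 < t n" "\<And>n. t (Suc n) < t n"
      "\<And>n. links (min (r (Suc n)) (t n / 2)) (t (Suc n))" "\<And>d. 0 < d \<Longrightarrow> \<exists>n. t n < d"
      by (rule scales_exist[OF r(1)], rule that)
    interpret coloured X V P h k D r t
      by unfold_locales (use D r t in auto)
    show ?thesis by (rule edge_partition[OF dense])
  qed
qed

end
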